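(* Let $D$ be a 2-strong digraph of order $p\geq 3$ and let $z$ be some vertex of $D$. Suppose that $d(x)\geq p$ for each vertex $x\in V(D)\setminus\{z\}$. If $D$ is Hamiltonian or $d(z)>(p-1)/3$, then $D$ has a Hamiltonian bypass.
   Context: All digraphs are finite, without loops and without multiple arcs; opposite arcs $xy$ and $yx$ may both be present. For a digraph $D$, $V(D)$ is its vertex set, $A(D)$ its arc set, and its order is $|V(D)|$. The arc from $x$ to $y$ is denoted $xy$, and if $xy\in A(D)$ one says that $x$ dominates $y$. The out-degree $d^+(x)$ is the number of vertices $y$ with $xy\in A(D)$, the in-degree $d^-(x)$ is the number of vertices $y$ with $yx\in A(D)$, and the degree is $d(x)=d^+(x)+d^-(x)$. Paths and cycles are simple and directed (cycles of length two are allowed). A digraph is Hamiltonian if it has a cycle passing through all its vertices. A Hamiltonian path is a path passing through all vertices. A Hamiltonian bypass in a digraph $D$ of order $p$ is a Hamiltonian path $x_1x_2\ldots x_p$ of $D$ whose initial vertex dominates its terminal vertex, i.e. $x_1x_p\in A(D)$. A digraph is strong if for every pair of distinct vertices $x,y$ there are a path from $x$ to $y$ and a path from $y$ to $x$. A digraph $D$ is $k$-strong if $|V(D)|\geq k+1$ and the subdigraph of $D$ induced by $V(D)\setminus X$ is strong for every set $X$ of at most $k-1$ vertices. *)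

theory Defs
  imports "Graph_Theory.Graph_Theory"
begin

definition total_degree :: "('a, 'b) pre_digraph \<Rightarrow> 'a \<Rightarrow> nat" where
  "total_degree D x = out_degree D x + in_degree D x"

definition k_strong :: "nat \<Rightarrow> ('a, 'b) pre_digraph \<Rightarrow> bool" where
  "k_strong k D \<longleftrightarrow> card (verts D) \<ge> k + 1 \<and>
     (\<forall>X \<subseteq> verts D. card X < k \<longrightarrow> strongly_connected (D \<restriction> (verts D - X)))"

text \<open>
  The library's cycles may have length one (a loop); in a loopless digraph the shortest
  cycles have length two.
\<close>

definition hamiltonian :: "('a, 'b) pre_digraph \<Rightarrow> bool" where
  "hamiltonian D \<longleftrightarrow> (\<exists>u c. pre_digraph.cycle D c \<and> pre_digraph.awalk D u c u \<and>
     set (pre_digraph.awalk_verts D u c) = verts D)"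

definition hamiltonian_path :: "('a, 'b) pre_digraph \<Rightarrow> 'a \<Rightarrow> 'b awalk \<Rightarrow> 'a \<Rightarrow> bool" where
  "hamiltonian_path D u P v \<longleftrightarrow>
     pre_digraph.apath D u P v \<and> set (pre_digraph.awalk_verts D u P) = verts D"

definition has_hamiltonian_bypass :: "('a, 'b) pre_digraph \<Rightarrow> bool" where
  "has_hamiltonian_bypass D \<longleftrightarrow> (\<exists>u P v. hamiltonian_path D u P v \<and> u \<rightarrow>\<^bsub>D\<^esub> v)"

end

theory Submission
  imports Defs
begin

text \<open>
  Only the relation \<open>E\<close> of arcs on the vertex set \<open>V\<close> matters. Let \<open>p = card V\<close>; all vertices except \<open>z\<close>
  have degree at least \<open>p\<close>. Two facts recur. A vertex \<open>v \<noteq> z\<close> that is the only one missed by a cycle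
  gives a bypass, since two consecutive vertices of the cycle have arcs in the same direction to or
  from \<open>v\<close> (\<open>bypass_if_cycle_misses_one\<close>). And if a path of \<open>t\<close> vertices runs off a longest cycle of length
  \<open>m\<close>, the in-neighbours of its start and the out-neighbours of its end on the cycle number at most
  \<open>m - t + 1\<close> together, provided that both exist (\<open>attachment_bound\<close>).

  Suppose that there is a Hamiltonian cycle \<open>x\<^sub>0 = z, \<dots>, x\<^sub>p = z\<close> but no bypass. By induction on the distance, no
  two vertices \<open>x\<^sub>a\<close>, \<open>x\<^sub>b\<close> with \<open>a + 2 \<le> b\<close> and \<open>b - a < p\<close> are adjacent: the vertices between them are
  joined to each other only along the cycle, so that each has enough neighbours on the complementary path
  to be inserted there. All of them can then be inserted at once (\<open>insert_all\<close>), so an arc \<open>x\<^sub>b x\<^sub>a\<close> gives a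
  bypass, and an arc \<open>x\<^sub>a x\<^sub>b\<close> a cycle that misses a single vertex other than \<open>z\<close>. At distance \<open>p - 1\<close>
  this contradicts the arc from \<open>x\<^sub>p = x\<^sub>0\<close> to \<open>x\<^sub>1\<close> (\<open>bypass_if_hamiltonian\<close>).

  If there is no Hamiltonian cycle, a strengthening of the theorem of Ghouila-Houri shows that a longest
  cycle misses only \<open>z\<close>, or only \<open>z\<close> and a vertex forming a 2-cycle with it
  (\<open>longest_cycle_one_exception\<close>). Its proof takes a second cycle off the longest one, supplied by induction,
  and adds up the attachment bounds round it; the degree condition asks for more. The second alternative
  leads directly to a bypass. In the first one, in the absence of a bypass the in-neighbours of \<open>z\<close> on the
  cycle are at least three steps apart, and so are the out-neighbours. If in addition no
  out-neighbour follows an in-neighbour within five steps, then \<open>3 d(z) \<le> p - 1\<close>. This is the source of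
  the bound on \<open>d(z)\<close>: when it is violated, some cycle through \<open>z\<close> misses at most four vertices
  (\<open>deg_exception_small\<close>).

  Finally take a longest cycle through \<open>z\<close> and let \<open>R\<close> be the set of at most four vertices that it misses.
  If \<open>R\<close> is not strong, it consists of two 2-cycles, and there is a cut vertex. If it is strong, it has a
  Hamiltonian cycle. As the cycle through \<open>z\<close> is longest, all of its vertices dominated from \<open>R\<close>
  come, counting from \<open>z\<close>, before those that dominate vertices of \<open>R\<close>; and as there is no bypass, two
  consecutive vertices of \<open>R\<close> cannot share attachments that follow each other. This leaves both with too
  small a degree (\<open>long_z_cycle.impossible\<close>).
\<close>

section \<open>Paths and cycles as vertex lists\<close>

definition dpath :: "('a \<times> 'a) set \<Rightarrow> 'a list \<Rightarrow> bool" where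
  "dpath E P \<longleftrightarrow> P \<noteq> [] \<and> distinct P \<and> successively (\<lambda>x y. (x, y) \<in> E) P"

definition dcycle :: "('a \<times> 'a) set \<Rightarrow> 'a list \<Rightarrow> bool" where
  "dcycle E xs \<longleftrightarrow> dpath E xs \<and> (last xs, hd xs) \<in> E"

text \<open>
  The successor of \<open>a\<close> in the cyclic order of \<open>xs\<close>. Any list without repetitions carries such an order,
  also when it is only a path of the digraph.
\<close>

definition nxt :: "'a list \<Rightarrow> 'a \<Rightarrow> 'a" where
  "nxt xs a = xs ! (Suc (THE i. i < length xs \<and> xs ! i = a) mod length xs)"

lemma dpath_append:
  "P \<noteq> [] \<Longrightarrow> Q \<noteq> [] \<Longrightarrow> dpath E (P @ Q) \<longleftrightarrow>
     dpath E P \<and> dpath E Q \<and> set P \<inter> set Q = {} \<and> (last P, hd Q) \<in> E"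
  by (auto simp: dpath_def successively_append_iff)

lemma dpath_single [simp]: "dpath E [a]"
  by (simp add: dpath_def)

lemma dpath_rev: "dpath (E\<inverse>) (rev P) \<longleftrightarrow> dpath E P"
  by (auto simp: dpath_def)

lemma dcycle_rev: "dcycle (E\<inverse>) (rev xs) \<longleftrightarrow> dcycle E xs"
  by (auto simp: dcycle_def dpath_rev hd_rev last_rev)

lemma dcycle_append_swap: "dcycle E (P @ Q) \<Longrightarrow> dcycle E (Q @ P)"
  by (cases "P = []"; cases "Q = []") (auto simp: dcycle_def dpath_append)

lemma dcycle_not_empty: "dcycle E xs \<Longrightarrow> xs \<noteq> []"
  by (simp add: dcycle_def dpath_def)

lemma dcycle_distinct: "dcycle E xs \<Longrightarrow> distinct xs"
  by (simp add: dcycle_def dpath_def)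

lemma dcycle_card: "dcycle E P \<Longrightarrow> card (set P) = length P"
  by (simp add: dcycle_def dpath_def distinct_card)

lemma dcycle_ge2: "irrefl E \<Longrightarrow> dcycle E xs \<Longrightarrow> length xs \<ge> 2"
proof (rule ccontr)
  assume "irrefl E" "dcycle E xs" "\<not> length xs \<ge> 2"
  then obtain a where "xs = [a]" using dcycle_not_empty[of E xs]
    by (cases xs; cases "tl xs") auto
  with \<open>irrefl E\<close> \<open>dcycle E xs\<close> show False by (auto simp: dcycle_def irrefl_def)
qed

lemma nxt_nth:
  assumes "distinct xs" "i < length xs"
  shows "nxt xs (xs ! i) = xs ! (Suc i mod length xs)"
proof -
  have "(THE k. k < length xs \<and> xs ! k = xs ! i) = i"
    using assms by (intro the_equality) (auto simp: nth_eq_iff_index_eq)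
  then show ?thesis by (simp add: nxt_def)
qed

lemma nxt_pow_nth:
  assumes "distinct xs" "i < length xs"
  shows "(nxt xs ^^ k) (xs ! i) = xs ! ((i + k) mod length xs)"
proof (induction k)
  case 0 then show ?case using assms by simp
next
  case (Suc k)
  have "(i + k) mod length xs < length xs" using assms by (intro mod_less_divisor) auto
  then show ?case using Suc nxt_nth[OF assms(1)] by (simp add: mod_Suc_eq)
qed

lemma nxt_in: "distinct xs \<Longrightarrow> a \<in> set xs \<Longrightarrow> nxt xs a \<in> set xs"
  by (auto simp: in_set_conv_nth nxt_nth) (metis gr_implies_not0 mod_less_divisor neq0_conv)

lemma nxt_pow_in: "distinct xs \<Longrightarrow> a \<in> set xs \<Longrightarrow> (nxt xs ^^ k) a \<in> set xs"
  by (induction k) (auto simp: nxt_in)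

lemma nxt_onto:
  assumes "distinct xs" "b \<in> set xs"
  shows "\<exists>a\<in>set xs. nxt xs a = b"
proof -
  obtain j where j: "j < length xs" "xs ! j = b" using assms by (auto simp: in_set_conv_nth)
  define i where "i = (if j = 0 then length xs - 1 else j - 1)"
  have "i < length xs" "Suc i mod length xs = j" using j by (auto simp: i_def)
  then have "nxt xs (xs ! i) = b" using nxt_nth[OF assms(1)] j by auto
  with \<open>i < length xs\<close> show ?thesis by auto
qed

lemma nxt_bij: "distinct xs \<Longrightarrow> bij_betw (nxt xs) (set xs) (set xs)"
proof -
  assume d: "distinct xs"
  have im: "nxt xs ` set xs = set xs" using nxt_in[OF d] nxt_onto[OF d] by fastforce
  then have "inj_on (nxt xs) (set xs)" by (simp add: eq_card_imp_inj_on)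
  with im show ?thesis by (simp add: bij_betw_def)
qed

lemma nxt_reaches:
  assumes "distinct xs" "a \<in> set xs" "b \<in> set xs"
  shows "\<exists>k. 1 \<le> k \<and> k \<le> length xs \<and> (nxt xs ^^ k) a = b"
proof -
  obtain i where i: "i < length xs" "xs ! i = a" using assms by (auto simp: in_set_conv_nth)
  obtain j where j: "j < length xs" "xs ! j = b" using assms by (auto simp: in_set_conv_nth)
  define k where "k = (if j > i then j - i else length xs + j - i)"
  have "1 \<le> k" "k \<le> length xs" using i j by (auto simp: k_def)
  moreover have "(i + k) mod length xs = j" using i j by (auto simp: k_def)
  ultimately show ?thesis using nxt_pow_nth[OF assms(1) i(1), of k] i j by auto
qed

text \<open>
  A cyclic order has no proper invariant subset. Arguments that go round a cycle until a property
  changes take this form.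
\<close>

lemma nxt_invariant:
  assumes "distinct xs" "a \<in> set xs" "Q a"
    and "\<And>x. x \<in> set xs \<Longrightarrow> Q x \<Longrightarrow> Q (nxt xs x)"
    and "b \<in> set xs"
  shows "Q b"
proof -
  have "Q ((nxt xs ^^ k) a)" for k
    by (induction k) (auto intro: assms nxt_pow_in)
  then show ?thesis using nxt_reaches[OF assms(1,2,5)] by auto
qed

text \<open>Reversing a list inverts its cyclic order; this transports statements about in-neighbours
  to statements about out-neighbours in the converse relation.\<close>

lemma nxt_rev:
  assumes "distinct xs" "a \<in> set xs"
  shows "nxt (rev xs) (nxt xs a) = a"
proof -
  obtain i where i: "i < length xs" "xs ! i = a" using assms by (auto simp: in_set_conv_nth)
  let ?n = "length xs"
  show ?thesis
  proof (cases "Suc i = ?n")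
    case True
    then have "nxt xs a = xs ! 0" using nxt_nth[OF assms(1) i(1)] i by simp
    also have "\<dots> = rev xs ! (?n - 1)" using i by (simp add: rev_nth)
    finally have 1: "nxt xs a = rev xs ! (?n - 1)" .
    have "nxt (rev xs) (rev xs ! (?n - 1)) = rev xs ! (Suc (?n - 1) mod ?n)"
      using nxt_nth[of "rev xs" "?n - 1"] assms i by auto
    also have "Suc (?n - 1) mod ?n = 0" by (metis True diff_Suc_1 mod_self)
    also have "rev xs ! 0 = xs ! (?n - Suc 0)" using i(1) by (intro rev_nth) linarith
    also have "xs ! (?n - Suc 0) = a" by (metis True diff_Suc_1 i(2) One_nat_def)
    finally show ?thesis using 1 by simp
  next
    case False
    then have "nxt xs a = xs ! Suc i" using nxt_nth[OF assms(1) i(1)] i by simp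
    also have "\<dots> = rev xs ! (?n - 2 - i)" using i False by (simp add: rev_nth Suc_diff_Suc numeral_2_eq_2)
    finally have 1: "nxt xs a = rev xs ! (?n - 2 - i)" .
    have "nxt (rev xs) (rev xs ! (?n - 2 - i)) = rev xs ! (Suc (?n - 2 - i) mod ?n)"
      using nxt_nth[of "rev xs" "?n - 2 - i"] assms i by auto
    also have "Suc (?n - 2 - i) mod ?n = ?n - 1 - i" using i False by simp
    also have "rev xs ! (?n - 1 - i) = a" using i by (simp add: rev_nth)
    finally show ?thesis using 1 by simp
  qed
qed

lemma dcycle_rotate:
  assumes "dcycle E xs" "a \<in> set xs"
  obtains ys where "dcycle E ys" "set ys = set xs" "length ys = length xs" "last ys = a"
    "hd ys = nxt xs a" "\<And>k. k < length xs \<Longrightarrow> ys ! k = (nxt xs ^^ Suc k) a"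
proof -
  have d: "distinct xs" using assms dcycle_distinct by blast
  obtain i where i: "i < length xs" "xs ! i = a" using assms by (auto simp: in_set_conv_nth)
  define ys where "ys = drop (Suc i) xs @ take (Suc i) xs"
  have "dcycle E (take (Suc i) xs @ drop (Suc i) xs)" using assms by simp
  then have c: "dcycle E ys" unfolding ys_def by (rule dcycle_append_swap)
  have s: "set ys = set xs" unfolding ys_def
    by (metis append_take_drop_id inf_sup_aci(5) set_append)
  have l: "length ys = length xs" unfolding ys_def using i by simp
  have la: "last ys = a" unfolding ys_def using i by (simp add: take_Suc_conv_app_nth)
  have nt: "ys ! k = (nxt xs ^^ Suc k) a" if "k < length xs" for k
  proof -
    have "ys ! k = xs ! ((i + Suc k) mod length xs)"
    proof (cases "k < length xs - Suc i")
      case True then show ?thesis using i by (simp add: ys_def nth_append)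
    next
      case False
      then have "(i + Suc k) mod length xs = i + Suc k - length xs" using that i
        by (simp add: le_mod_geq)
      then show ?thesis using False i that by (simp add: ys_def nth_append add.commute)
    qed
    then show ?thesis using nxt_pow_nth[OF d i(1), of "Suc k"] i by simp
  qed
  have "hd ys = ys ! 0" using l i by (intro hd_conv_nth) auto
  moreover have "0 < length xs" using i(1) by linarith
  ultimately have "hd ys = nxt xs a" using nt[of 0] by simp
  then show ?thesis using that c s l la nt by blast
qed

lemma dcycle_arc: "dcycle E xs \<Longrightarrow> a \<in> set xs \<Longrightarrow> (a, nxt xs a) \<in> E"
  by (metis dcycle_def dcycle_rotate)

text \<open>The \<open>l - 1\<close> vertices strictly between \<open>a\<close> and its \<open>l\<close>-th successor are exchanged for those of \<open>P\<close>.\<close>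

lemma dcycle_detour:
  assumes "dcycle E xs" "a \<in> set xs" "1 \<le> l" "l \<le> length xs"
    and "dpath E P" "set P \<inter> set xs = {}"
    and "(a, hd P) \<in> E" "(last P, (nxt xs ^^ l) a) \<in> E"
  shows "\<exists>zs. dcycle E zs \<and> length zs + l = length xs + length P + 1 \<and>
    set P \<subseteq> set zs \<and> set zs \<subseteq> set xs \<union> set P"
proof -
  obtain ys where ys: "dcycle E ys" "set ys = set xs" "length ys = length xs" "last ys = a"
    "hd ys = nxt xs a" "\<And>k. k < length xs \<Longrightarrow> ys ! k = (nxt xs ^^ Suc k) a"
    using dcycle_rotate assms by metis
  define Q where "Q = drop (l - 1) ys"
  have Q: "Q \<noteq> []" "last Q = a" "length Q + l = length xs + 1" "set Q \<subseteq> set xs"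
    using assms ys by (auto simp: Q_def dest: in_set_dropD)
  have "hd Q = (nxt xs ^^ l) a" using assms ys(6)[of "l - 1"] ys(3)
    by (simp add: Q_def hd_drop_conv_nth del: funpow.simps)
  moreover have "dpath E Q"
  proof -
    have "dpath E (take (l - 1) ys @ Q)" using ys(1) by (simp add: Q_def dcycle_def)
    then show ?thesis using Q(1) by (cases "take (l - 1) ys = []") (auto simp: dpath_append)
  qed
  ultimately have "dcycle E (Q @ P)" using Q assms
    by (auto simp: dcycle_def dpath_append dpath_def successively_append_iff)
  moreover have "length (Q @ P) + l = length xs + length P + 1" using Q by simp
  ultimately show ?thesis using Q(4) by (intro exI[of _ "Q @ P"]) auto
qed

lemma rtrancl_dpath:
  assumes "(x, y) \<in> (E \<inter> S \<times> S)\<^sup>*" "x \<in> S"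
  shows "\<exists>P. dpath E P \<and> set P \<subseteq> S \<and> hd P = x \<and> last P = y"
  using assms
proof (induction rule: rtrancl_induct)
  case base
  then show ?case by (intro exI[of _ "[x]"]) auto
next
  case (step y z)
  then obtain P where P: "dpath E P" "set P \<subseteq> S" "hd P = x" "last P = y" by auto
  show ?case
  proof (cases "z \<in> set P")
    case True
    then obtain us vs where uv: "P = us @ z # vs" by (auto simp: in_set_conv_decomp)
    then have "dpath E (us @ [z])" using P(1) by (cases vs) (auto simp: dpath_def successively_append_iff)
    moreover have "hd (us @ [z]) = x" using P(3) uv by (cases us) auto
    ultimately show ?thesis using P(2) uv by (intro exI[of _ "us @ [z]"]) auto
  next
    case False
    have "P \<noteq> []" using P(1) by (simp add: dpath_def)
    then have "dpath E (P @ [z])" using P False step by (auto simp: dpath_append)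
    then show ?thesis using P step \<open>P \<noteq> []\<close> by (intro exI[of _ "P @ [z]"]) auto
  qed
qed

section \<open>Neighbourhoods, degrees and strong sets\<close>

definition outs :: "('a \<times> 'a) set \<Rightarrow> 'a set \<Rightarrow> 'a \<Rightarrow> 'a set" where
  "outs E S v = {y \<in> S. (v, y) \<in> E}"

definition ins :: "('a \<times> 'a) set \<Rightarrow> 'a set \<Rightarrow> 'a \<Rightarrow> 'a set" where
  "ins E S v = {y \<in> S. (y, v) \<in> E}"

definition deg :: "('a \<times> 'a) set \<Rightarrow> 'a set \<Rightarrow> 'a \<Rightarrow> nat" where
  "deg E S v = card (outs E S v) + card (ins E S v)"

definition strong_on :: "('a \<times> 'a) set \<Rightarrow> 'a set \<Rightarrow> bool" where
  "strong_on E S \<longleftrightarrow> (\<forall>x\<in>S. \<forall>y\<in>S. (x, y) \<in> (E \<inter> S \<times> S)\<^sup>*)"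

lemma outs_converse [simp]: "outs (E\<inverse>) S v = ins E S v"
  and ins_converse [simp]: "ins (E\<inverse>) S v = outs E S v"
  by (auto simp: outs_def ins_def)

lemma deg_converse [simp]: "deg (E\<inverse>) S v = deg E S v"
  by (simp add: deg_def)

lemma strong_on_converse [simp]: "strong_on (E\<inverse>) S \<longleftrightarrow> strong_on E S"
proof -
  have "E\<inverse> \<inter> S \<times> S = (E \<inter> S \<times> S)\<inverse>" by auto
  then show ?thesis unfolding strong_on_def by (auto simp: rtrancl_converse)
qed

lemma irrefl_converse' [simp]: "irrefl (E\<inverse>) \<longleftrightarrow> irrefl E"
  by (auto simp: irrefl_def)

lemma outs_subset: "outs E S v \<subseteq> S" and ins_subset: "ins E S v \<subseteq> S"
  by (auto simp: outs_def ins_def)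

lemma finite_outs [simp]: "finite S \<Longrightarrow> finite (outs E S v)"
  and finite_ins [simp]: "finite S \<Longrightarrow> finite (ins E S v)"
  by (auto simp: outs_def ins_def)

lemma deg_Un:
  assumes "finite A" "finite B" "A \<inter> B = {}"
  shows "deg E (A \<union> B) v = deg E A v + deg E B v"
proof -
  have "outs E (A \<union> B) v = outs E A v \<union> outs E B v" "ins E (A \<union> B) v = ins E A v \<union> ins E B v"
    by (auto simp: outs_def ins_def)
  moreover have "outs E A v \<inter> outs E B v = {}" "ins E A v \<inter> ins E B v = {}"
    using assms by (auto simp: outs_def ins_def)
  ultimately show ?thesis using assms by (simp add: deg_def card_Un_disjoint)
qed

lemma deg_split:
  assumes "finite V" "A \<subseteq> V"
  shows "deg E V v = deg E A v + deg E (V - A) v"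
proof -
  have "A \<union> (V - A) = V" using assms by auto
  then show ?thesis using deg_Un[of A "V - A" E v] assms finite_subset by fastforce
qed

lemma card_outs_le: "finite S \<Longrightarrow> card (outs E S v) \<le> card S"
  and card_ins_le: "finite S \<Longrightarrow> card (ins E S v) \<le> card S"
  by (auto intro!: card_mono simp: outs_def ins_def)

lemma deg_le_irrefl:
  assumes "finite S" "irrefl E" "v \<in> S"
  shows "deg E S v + 2 \<le> 2 * card S"
proof -
  have "outs E S v \<subseteq> S - {v}" "ins E S v \<subseteq> S - {v}" using assms by (auto simp: outs_def ins_def irrefl_def)
  then have "card (outs E S v) \<le> card (S - {v})" "card (ins E S v) \<le> card (S - {v})"
    using assms by (auto intro!: card_mono simp del: card_Diff_insert card_Diff_singleton)
  moreover have "card (S - {v}) + 1 = card S" using assms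
    by (metis Suc_eq_plus1 card_Suc_Diff1)
  ultimately show ?thesis by (simp add: deg_def)
qed

lemma card_outs_eq_sum: "finite S \<Longrightarrow> card (outs E S v) = (\<Sum>w\<in>S. of_bool ((v, w) \<in> E))"
  by (simp add: outs_def of_bool_def sum.If_cases Int_def)

lemma card_ins_eq_sum: "finite S \<Longrightarrow> card (ins E S v) = (\<Sum>w\<in>S. of_bool ((w, v) \<in> E))"
  by (simp add: ins_def of_bool_def sum.If_cases Int_def)

lemma sum_deg_swap:
  assumes "finite A" "finite B"
  shows "(\<Sum>a\<in>A. deg E B a) = (\<Sum>b\<in>B. deg E A b)"
proof -
  have "(\<Sum>a\<in>A. deg E B a) = (\<Sum>a\<in>A. \<Sum>b\<in>B. of_bool ((a, b) \<in> E) + of_bool ((b, a) \<in> E))"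
    using assms by (simp add: deg_def card_outs_eq_sum card_ins_eq_sum sum.distrib)
  also have "\<dots> = (\<Sum>b\<in>B. \<Sum>a\<in>A. of_bool ((a, b) \<in> E) + of_bool ((b, a) \<in> E))"
    by (rule sum.swap)
  also have "\<dots> = (\<Sum>b\<in>B. deg E A b)"
    using assms by (simp add: deg_def card_outs_eq_sum card_ins_eq_sum sum.distrib)
  finally show ?thesis .
qed

lemma strong_on_path:
  assumes "strong_on E S" "x \<in> S" "y \<in> S"
  obtains P where "dpath E P" "set P \<subseteq> S" "hd P = x" "last P = y"
  using rtrancl_dpath[of x y E S] assms by (auto simp: strong_on_def)

lemma strong_on_leaves:
  assumes "strong_on E V" "S \<subseteq> V" "S \<noteq> {}" "V - S \<noteq> {}"
  shows "\<exists>x\<in>S. \<exists>y\<in>V - S. (x, y) \<in> E"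
proof (rule ccontr)
  assume no: "\<not> ?thesis"
  obtain x y where xy: "x \<in> S" "y \<in> V - S" using assms by auto
  have "(x, y) \<in> (E \<inter> V \<times> V)\<^sup>*" using assms xy by (auto simp: strong_on_def)
  then have "y \<in> S"
    by (induction rule: rtrancl_induct) (use no xy in auto)
  with xy show False by simp
qed

lemma strong_on_cycle:
  assumes "irrefl E" "strong_on E S" "x \<in> S" "y \<in> S" "x \<noteq> y"
  shows "\<exists>ys. dcycle E ys \<and> set ys \<subseteq> S"
proof -
  have "S - {x} \<noteq> {}" "{x} \<subseteq> S" using assms by auto
  then obtain w where w: "w \<in> S - {x}" "(x, w) \<in> E" using strong_on_leaves[OF assms(2), of "{x}"] by auto
  obtain P where P: "dpath E P" "set P \<subseteq> S" "hd P = w" "last P = x"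
    using strong_on_path[OF assms(2), of w x] assms w by auto
  then have "dcycle E P" using w by (simp add: dcycle_def)
  with P show ?thesis by auto
qed

section \<open>Paths attached to a longest cycle\<close>

text \<open>Sumset growth in a cyclic order: each further shift adds a new element until the
  whole cycle is reached.\<close>

lemma nxt_shifts_card:
  assumes "distinct xs" "S \<subseteq> set xs" "S \<noteq> {}"
  shows "card (\<Union>l\<in>{1..Suc t}. (nxt xs ^^ l) ` S) \<ge> min (length xs) (card S + t)"
proof (induction t)
  case 0
  have "inj_on (nxt xs) S" using nxt_bij[OF assms(1)] assms(2)
    by (metis bij_betw_imp_inj_on inj_on_subset)
  then show ?case by (simp add: card_image)
next
  case (Suc t)
  let ?U = "\<lambda>t. \<Union>l\<in>{1..Suc t}. (nxt xs ^^ l) ` S"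
  have sub: "?U t \<subseteq> set xs" for t using nxt_pow_in[OF assms(1)] assms(2) by blast
  have mono: "?U t \<subseteq> ?U (Suc t)" by (intro UN_mono) auto
  have fin: "finite (?U t)" for t using sub finite_subset by blast
  show ?case
  proof (cases "?U (Suc t) = ?U t")
    case True
    obtain a where a: "a \<in> S" using assms by auto
    have inv: "nxt xs x \<in> ?U t" if x: "x \<in> ?U t" for x
    proof -
      obtain l s where l: "l \<in> {1..Suc t}" "s \<in> S" "x = (nxt xs ^^ l) s" using x by blast
      then have "nxt xs x = (nxt xs ^^ Suc l) s" "Suc l \<in> {1..Suc (Suc t)}" by auto
      then have "nxt xs x \<in> ?U (Suc t)" using l(2) by blast
      then show ?thesis using True by blast
    qed
    have 1: "(nxt xs ^^ 1) a \<in> ?U t" by (rule UN_I[of 1]) (use a in auto)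
    then have 2: "(nxt xs ^^ 1) a \<in> set xs" using sub by blast
    have "b \<in> ?U t" if "b \<in> set xs" for b
      by (rule nxt_invariant[where Q = "\<lambda>x. x \<in> ?U t", OF assms(1) 2 1 _ that]) (rule inv)
    then have "?U t = set xs" using sub by blast
    then have "card (?U (Suc t)) = length xs" using True assms(1) by (metis distinct_card)
    then show ?thesis by simp
  next
    case False
    then have "?U t \<subset> ?U (Suc t)" using mono by blast
    then have "card (?U t) < card (?U (Suc t))" using fin by (intro psubset_card_mono)
    then show ?thesis using Suc.IH by linarith
  qed
qed

text \<open>
  Everything in this locale is invariant under reversing all arcs (lemma \<open>dual\<close>), so that each
  statement about out-neighbours has a counterpart about in-neighbours.
\<close>

locale longest_cycle =
  fixes E :: "('a \<times> 'a) set" and V :: "'a set" and xs :: "'a list"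
  assumes finite_V: "finite V" and irrefl: "irrefl E" and strong: "strong_on E V"
    and cycle: "dcycle E xs" and cycle_in: "set xs \<subseteq> V"
    and longest: "\<And>zs. dcycle E zs \<Longrightarrow> set zs \<subseteq> V \<Longrightarrow> length zs \<le> length xs"
begin

abbreviation "C \<equiv> set xs"
abbreviation "m \<equiv> length xs"
abbreviation "R \<equiv> V - set xs"

lemma dual: "longest_cycle (E\<inverse>) V (rev xs)"
proof
  fix zs assume "dcycle (E\<inverse>) zs" "set zs \<subseteq> V"
  then have "dcycle E (rev zs)" "set (rev zs) \<subseteq> V" using dcycle_rev[of "E" "rev zs"] by auto
  then show "length zs \<le> length (rev xs)" using longest[of "rev zs"] by simp
qed (use finite_V irrefl strong cycle cycle_in in \<open>auto simp: dcycle_rev\<close>)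

lemma no_detour:
  assumes "dpath E P" "set P \<subseteq> R" "a \<in> ins E C (hd P)" "1 \<le> l" "l \<le> length P" "l \<le> m"
  shows "(nxt xs ^^ l) a \<notin> outs E C (last P)"
proof
  assume o: "(nxt xs ^^ l) a \<in> outs E C (last P)"
  have "\<exists>zs. dcycle E zs \<and> length zs + l = length xs + length P + 1 \<and>
      set P \<subseteq> set zs \<and> set zs \<subseteq> set xs \<union> set P"
    using assms o by (intro dcycle_detour[OF cycle]) (auto simp: ins_def outs_def)
  then obtain zs where "dcycle E zs" "length zs + l = m + length P + 1" "set zs \<subseteq> V"
    using assms(2) cycle_in by blast
  with longest[of zs] assms show False by simp
qed

text \<open>
  An arc from \<open>a\<close> to the start of a path off the cycle forbids arcs from its end to any of the
  next \<open>length P\<close> vertices after \<open>a\<close>; the bound is the cardinality of these forbidden vertices.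
\<close>

lemma attachment_bound:
  assumes "dpath E P" "set P \<subseteq> R" "ins E C (hd P) \<noteq> {}" "outs E C (last P) \<noteq> {}"
  shows "card (ins E C (hd P)) + card (outs E C (last P)) + length P \<le> m + 1"
proof -
  let ?I = "ins E C (hd P)" and ?O = "outs E C (last P)"
  have d: "distinct xs" using cycle dcycle_distinct by blast
  have "length P \<ge> 1" using assms(1) by (cases P) (auto simp: dpath_def)
  define t where "t = min (length P) m - 1"
  have m: "m \<ge> 1" using dcycle_not_empty[OF cycle] by (cases xs) auto
  let ?U = "\<Union>l\<in>{1..Suc t}. (nxt xs ^^ l) ` ?I"
  have "Suc t \<le> length P" "Suc t \<le> m" using \<open>length P \<ge> 1\<close> m by (auto simp: t_def)
  then have "(nxt xs ^^ l) a \<notin> ?O" if "a \<in> ?I" "l \<in> {1..Suc t}" for a l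
    using no_detour[OF assms(1,2) that(1)] that(2) by auto
  then have dis: "?U \<inter> ?O = {}" by (simp only: disjoint_iff UN_iff image_iff) metis
  have "(nxt xs ^^ l) a \<in> C" if "a \<in> ?I" for a l
    using that nxt_pow_in[OF d, of a] by (simp add: ins_def)
  then have sub: "?U \<subseteq> C" by (simp only: UN_subset_iff image_subset_iff) metis
  have "finite ?U" by (rule finite_subset[OF sub]) simp
  then have "card ?U + card ?O = card (?U \<union> ?O)"
    using dis by (intro card_Un_disjoint[symmetric]) auto
  also have "\<dots> \<le> card C" using sub outs_subset[of E C "last P"] by (intro card_mono Un_least) auto
  finally have 1: "card ?U + card ?O \<le> m" using distinct_card[OF d] by simp
  have 2: "card ?U \<ge> min m (card ?I + t)"
    using assms(3) by (intro nxt_shifts_card[OF d]) (auto simp: ins_def)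
  have 3: "card ?O \<ge> 1" using assms(4) by (simp add: Suc_leI card_gt_0_iff)
  have 4: "card ?I \<ge> 1" using assms(3) by (simp add: Suc_leI card_gt_0_iff)
  \<comment> \<open>The forbidden vertices cannot fill the whole cycle, as an out-neighbour exists.\<close>
  have "min m (card ?I + t) \<noteq> m" using 1 2 3 by linarith
  then have "card ?I + t + card ?O \<le> m" "card ?I + t < m" using 1 2 by auto
  moreover have "length P \<le> m"
    using \<open>card ?I + t < m\<close> 4 m unfolding t_def by linarith
  ultimately show ?thesis using m \<open>length P \<ge> 1\<close> unfolding t_def by linarith
qed

lemma deg_cycle_le:
  assumes "v \<in> R"
  shows "deg E C v \<le> m"
proof -
  have O: "card (outs E C v) \<le> m" and I: "card (ins E C v) \<le> m"
    using card_outs_le[of C E v] card_ins_le[of C E v] dcycle_card[OF cycle] by auto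
  show ?thesis
  proof (cases "ins E C v = {} \<or> outs E C v = {}")
    case True then show ?thesis using O I by (auto simp: deg_def)
  next
    case False
    then show ?thesis using attachment_bound[of "[v]"] assms by (simp add: deg_def)
  qed
qed

lemma card_V: "card V = m + card R"
  using dcycle_card[OF cycle] cycle_in finite_V
  by (metis List.finite_set card_Diff_subset card_mono le_add_diff_inverse)

text \<open>The cycle takes at most \<open>m\<close> from the degree of an outside vertex, so the degree
  condition is inherited by the vertices off the cycle. All inductions rest on this.\<close>

lemma deg_rest_ge:
  assumes "v \<in> R" "deg E V v \<ge> card V"
  shows "deg E R v \<ge> card R"
  using deg_split[OF finite_V cycle_in, of E v] deg_cycle_le[OF assms(1)] card_V assms(2) by simp

end

text \<open>Averaging: bounds on a quantity at \<open>nxt ys y\<close> together with another one at \<open>y\<close>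
  add up to bounds on the totals of both.\<close>

lemma sum_nxt:
  fixes f :: "'a \<Rightarrow> nat"
  assumes "distinct ys"
  shows "(\<Sum>y\<in>set ys. f (nxt ys y)) = (\<Sum>y\<in>set ys. f y)"
  using sum.reindex_bij_betw[OF nxt_bij[OF assms], of f] by simp

section \<open>A second cycle off a longest cycle\<close>

context longest_cycle
begin

text \<open>If no arc leads from \<open>K\<close> directly to the longest cycle, strong connectivity still provides a
  way there, and it uses vertices outside \<open>K\<close>. Appended to a path through \<open>K\<close> it makes the path long
  enough to exceed the attachment bound.\<close>

lemma leaves_to_cycle:
  assumes "K \<subseteq> R" "K \<noteq> {}" "\<And>y. y \<in> K \<Longrightarrow> outs E C y = {}"
  obtains e P where "e \<in> K" "dpath E P" "set P \<subseteq> R - K" "(e, hd P) \<in> E" "outs E C (last P) \<noteq> {}"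
proof -
  define T where "T = R - K"
  define S where "S = {v \<in> T. \<exists>w\<in>T. (v, w) \<in> (E \<inter> T \<times> T)\<^sup>* \<and> outs E C w \<noteq> {}}"
  define U where "U = V - C - S"
  have "K \<subseteq> U" using assms(1) by (auto simp: U_def S_def T_def)
  moreover have "V - U \<noteq> {}" using dcycle_not_empty[OF cycle] cycle_in by (cases xs) (auto simp: U_def)
  ultimately obtain x y where xy: "x \<in> U" "y \<in> V - U" "(x, y) \<in> E"
    using strong_on_leaves[OF strong, of U] assms(2) by (auto simp: U_def)
  have y: "y \<in> C \<or> y \<in> S" using xy by (auto simp: U_def)
  have "x \<in> K"
  proof (rule ccontr)
    assume "x \<notin> K"
    then have xT: "x \<in> T" using xy by (auto simp: U_def T_def)
    have "x \<in> S"
    proof (cases "y \<in> C")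
      case True
      then have "outs E C x \<noteq> {}" using xy by (auto simp: outs_def)
      then show ?thesis using xT by (auto simp: S_def)
    next
      case False
      then obtain w where w: "w \<in> T" "(y, w) \<in> (E \<inter> T \<times> T)\<^sup>*" "outs E C w \<noteq> {}" "y \<in> T"
        using y by (auto simp: S_def)
      then have "(x, w) \<in> (E \<inter> T \<times> T)\<^sup>*" using xT xy(3) by (intro converse_rtrancl_into_rtrancl[of x y]) auto
      then show ?thesis using w xT by (auto simp: S_def)
    qed
    then show False using xy by (simp add: U_def)
  qed
  then have "y \<notin> C" using assms(3)[of x] xy(3) by (auto simp: outs_def)
  then obtain w where w: "w \<in> T" "(y, w) \<in> (E \<inter> T \<times> T)\<^sup>*" "outs E C w \<noteq> {}" "y \<in> T"
    using y by (auto simp: S_def)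
  obtain P where "dpath E P" "set P \<subseteq> T" "hd P = y" "last P = w"
    using rtrancl_dpath[OF w(2,4)] by auto
  with that[of x P] \<open>x \<in> K\<close> xy w show ?thesis by (auto simp: T_def)
qed

end

text \<open>
  A second cycle disjoint from a longest one leads to a contradiction if it exchanges few arcs with the
  remaining vertices, on average at most one per pair of vertices, and if those vertices provide
  no detour from \<open>y\<close> to its successor. Two situations are covered: the second cycle spans an initial strong
  component of the digraph off the longest cycle, or it is a longest cycle there and the
  remaining vertices form a strong set.
\<close>

locale two_cycles = longest_cycle +
  fixes ys :: "'a list"
  assumes ys: "dcycle E ys" and ys_in: "set ys \<subseteq> V - set xs"
    and ys_deg: "\<And>y. y \<in> set ys \<Longrightarrow> deg E V y \<ge> card V"
    and rest_few: "(\<Sum>y\<in>set ys. deg E (V - set xs - set ys) y) \<le> length ys * card (V - set xs - set ys)"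
    and rest_no_detour: "\<And>y. y \<in> set ys \<Longrightarrow> outs E (V - set xs - set ys) y = {} \<or>
      ins E (V - set xs - set ys) (nxt ys y) = {}"
begin

abbreviation "K \<equiv> set ys"
abbreviation "c \<equiv> length ys"
abbreviation "R2 \<equiv> V - set xs - set ys"
abbreviation "\<tau> \<equiv> nxt ys"

lemma ys_distinct: "distinct ys"
  using ys dcycle_distinct by blast

lemma c_ge2: "c \<ge> 2"
  using ys irrefl dcycle_ge2 by blast

lemma c_le_m: "c \<le> m"
  using longest[OF ys] ys_in by blast

lemma finite_R2: "finite R2"
  using finite_V by auto

lemma card_V2: "card V = m + c + card R2"
proof -
  have "card R = card K + card R2" using ys_in finite_V
    by (metis List.finite_set card_Diff_subset card_mono finite_Diff le_add_diff_inverse)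
  then show ?thesis using card_V dcycle_card[OF ys] by simp
qed

lemma dual_two: "two_cycles (E\<inverse>) V (rev xs) (rev ys)"
proof -
  interpret D: longest_cycle "E\<inverse>" V "rev xs" by (rule dual)
  show ?thesis
  proof
    show "dcycle (E\<inverse>) (rev ys)" using ys by (simp add: dcycle_rev)
    show "set (rev ys) \<subseteq> V - set (rev xs)" using ys_in by simp
    show "deg (E\<inverse>) V y \<ge> card V" if "y \<in> set (rev ys)" for y using that ys_deg by simp
    show "(\<Sum>y\<in>set (rev ys). deg (E\<inverse>) (V - set (rev xs) - set (rev ys)) y)
      \<le> length (rev ys) * card (V - set (rev xs) - set (rev ys))" using rest_few by simp
    fix y assume y: "y \<in> set (rev ys)"
    then obtain x where x: "x \<in> K" "\<tau> x = y" using nxt_onto[OF ys_distinct] by auto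
    then have "nxt (rev ys) y = x" using nxt_rev[OF ys_distinct] by auto
    then show "outs (E\<inverse>) (V - set (rev xs) - set (rev ys)) y = {} \<or>
      ins (E\<inverse>) (V - set (rev xs) - set (rev ys)) (nxt (rev ys) y) = {}"
      using rest_no_detour[OF x(1)] x by auto
  qed
qed

text \<open>At most \<open>2 * (c - 1)\<close> arcs at \<open>y\<close> stay within the second cycle.\<close>

lemma deg_lower:
  assumes "y \<in> K"
  shows "card (ins E C y) + card (outs E C y) + deg E R2 y + c \<ge> m + card R2 + 2"
proof -
  have "deg E V y = deg E C y + deg E R y" by (rule deg_split[OF finite_V cycle_in])
  moreover have "deg E R y = deg E K y + deg E R2 y" 
    by (rule deg_split[OF _ ys_in]) (simp add: finite_V)
  moreover have "deg E K y + 2 \<le> 2 * c" using deg_le_irrefl[OF _ irrefl assms] dcycle_card[OF ys] by auto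
  ultimately show ?thesis using ys_deg[OF assms] card_V2 by (simp add: deg_def)
qed

lemma path_all:
  assumes "y \<in> K"
  obtains P where "dpath E P" "set P = K" "length P = c" "hd P = \<tau> y" "last P = y"
  using dcycle_rotate[OF ys assms] dcycle_def by metis

lemma path_but_one:
  assumes "y \<in> K"
  obtains P where "dpath E P" "set P \<subseteq> K" "length P + 1 = c" "hd P = \<tau> (\<tau> y)" "last P = y"
proof -
  obtain P where P: "dcycle E P" "set P = K" "length P = c" "last P = y"
    "\<And>k. k < c \<Longrightarrow> P ! k = (\<tau> ^^ Suc k) y"
    using dcycle_rotate[OF ys assms] by metis
  have ne: "tl P \<noteq> []" "P \<noteq> []" using P(3) c_ge2 by (cases P; cases "tl P"; auto)+
  have "dpath E ([hd P] @ tl P)" using P(1) ne by (simp add: dcycle_def)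
  then have "dpath E (tl P)" using ne by (subst (asm) dpath_append) auto
  moreover have "hd (tl P) = P ! 1" using ne by (metis One_nat_def hd_conv_nth nth_tl length_greater_0_conv)
  then have "hd (tl P) = \<tau> (\<tau> y)" using P(5)[of 1] c_ge2 by simp
  moreover have "last (tl P) = y" using ne P(4) by (simp add: last_tl)
  moreover have "set (tl P) \<subseteq> K" using P(2) ne by (metis list.set_sel(2) subsetI)
  moreover have "length (tl P) + 1 = c" using P(3) c_ge2 by simp
  ultimately show ?thesis using that[of "tl P"] by blast
qed

lemma bound_all:
  assumes "y \<in> K" "ins E C (\<tau> y) \<noteq> {}" "outs E C y \<noteq> {}"
  shows "card (ins E C (\<tau> y)) + card (outs E C y) + c \<le> m + 1"
proof -
  obtain P where "dpath E P" "set P = K" "length P = c" "hd P = \<tau> y" "last P = y"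
    using path_all[OF assms(1)] .
  then show ?thesis using attachment_bound[of P] assms ys_in by auto
qed

lemma bound_but_one:
  assumes "y \<in> K" "ins E C (\<tau> (\<tau> y)) \<noteq> {}" "outs E C y \<noteq> {}"
  shows "card (ins E C (\<tau> (\<tau> y))) + card (outs E C y) + c \<le> m + 2"
proof -
  obtain P where P: "dpath E P" "set P \<subseteq> K" "length P + 1 = c" "hd P = \<tau> (\<tau> y)" "last P = y"
    using path_but_one[OF assms(1)] .
  then have "set P \<subseteq> R" using ys_in by blast
  then show ?thesis using attachment_bound[of P] assms P by simp
qed

text \<open>Otherwise follow the second cycle round to a vertex \<open>e\<close> from which a path through
  the remaining vertices leads to the longest cycle. This path is so long that the successor of \<open>e\<close> has
  few in-neighbours on the longest cycle, hence needs an in-neighbour among the remaining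
  vertices, which completes a detour.\<close>

lemma some_out: "\<exists>y\<in>K. outs E C y \<noteq> {}"
proof (rule ccontr)
  assume "\<not> ?thesis"
  then have no: "\<And>y. y \<in> K \<Longrightarrow> outs E C y = {}" by auto
  have "K \<noteq> {}" using c_ge2 by auto
  then obtain e P where P: "e \<in> K" "dpath E P" "set P \<subseteq> R - K" "(e, hd P) \<in> E" "outs E C (last P) \<noteq> {}"
    using leaves_to_cycle[of K] ys_in no by metis
  obtain Q where Q: "dpath E Q" "set Q = K" "length Q = c" "hd Q = \<tau> e" "last Q = e"
    using path_all[OF P(1)] .
  have ne: "P \<noteq> []" "Q \<noteq> []" using P(2) Q(1) by (auto simp: dpath_def)
  have QP: "dpath E (Q @ P)" using P Q ne by (auto simp: dpath_append)
  have \<tau>e: "\<tau> e \<in> K" using P(1) nxt_in[OF ys_distinct] by blast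
  have "card (ins E C (\<tau> e)) + c \<le> m"
  proof (cases "ins E C (\<tau> e) = {}")
    case True then show ?thesis using c_le_m by simp
  next
    case False
    then have "card (ins E C (\<tau> e)) + card (outs E C (last P)) + length (Q @ P) \<le> m + 1"
      using attachment_bound[OF QP] P Q ne ys_in by auto
    then show ?thesis using ne Q by (cases P) auto
  qed
  moreover have "outs E C (\<tau> e) = {}" using no \<tau>e by blast
  ultimately have "deg E R2 (\<tau> e) \<ge> card R2 + 2" using deg_lower[OF \<tau>e] by simp
  moreover have "card (outs E R2 (\<tau> e)) \<le> card R2" using card_outs_le[OF finite_R2] .
  ultimately have "ins E R2 (\<tau> e) \<noteq> {}" by (auto simp: deg_def)
  moreover have "hd P \<in> R2" using P(3) hd_in_set[OF ne(1)] by blast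
  then have "hd P \<in> outs E R2 e" using P(4) by (simp add: outs_def)
  ultimately show False using rest_no_detour[OF P(1)] by auto
qed

text \<open>A vertex \<open>y'\<close> after one that sends arcs to the longest cycle receives few arcs from it. If
  \<open>y'\<close> and its successor send none, both must be joined to the rest in both directions,
  and the rest could be inserted between them.\<close>

lemma out_alternate:
  assumes "y \<in> K"
  shows "outs E C y \<noteq> {} \<or> outs E C (\<tau> y) \<noteq> {}"
proof -
  obtain y0 where y0: "y0 \<in> K" "outs E C y0 \<noteq> {}" using some_out by auto
  show ?thesis
  proof (rule nxt_invariant[OF ys_distinct y0(1) _ _ assms, where Q = "\<lambda>y. outs E C y \<noteq> {} \<or> outs E C (\<tau> y) \<noteq> {}"])
    show "outs E C y0 \<noteq> {} \<or> outs E C (\<tau> y0) \<noteq> {}" using y0 by simp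
  next
    fix x assume x: "x \<in> K" "outs E C x \<noteq> {} \<or> outs E C (\<tau> x) \<noteq> {}"
    show "outs E C (\<tau> x) \<noteq> {} \<or> outs E C (\<tau> (\<tau> x)) \<noteq> {}"
    proof (rule ccontr)
      assume "\<not> ?thesis"
      then have no: "outs E C (\<tau> x) = {}" "outs E C (\<tau> (\<tau> x)) = {}" by auto
      then have ox: "outs E C x \<noteq> {}" using x by blast
      then have ox1: "card (outs E C x) \<ge> 1" by (simp add: Suc_leI card_gt_0_iff)
      have K1: "\<tau> x \<in> K" "\<tau> (\<tau> x) \<in> K" using x(1) nxt_in[OF ys_distinct] by blast+
      have "card (ins E C (\<tau> x)) + c \<le> m"
        using bound_all[OF x(1) _ ox] ox1 c_le_m by (cases "ins E C (\<tau> x) = {}") auto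
      then have d1: "deg E R2 (\<tau> x) \<ge> card R2 + 2" using deg_lower[OF K1(1)] no by simp
      have "card (ins E C (\<tau> (\<tau> x))) + c \<le> m + 1"
        using bound_but_one[OF x(1) _ ox] ox1 c_le_m by (cases "ins E C (\<tau> (\<tau> x)) = {}") auto
      then have d2: "deg E R2 (\<tau> (\<tau> x)) \<ge> card R2 + 1" using deg_lower[OF K1(2)] no by simp
      have "outs E R2 (\<tau> x) \<noteq> {}" using d1 card_ins_le[OF finite_R2, of E "\<tau> x"] by (auto simp: deg_def)
      moreover have "ins E R2 (\<tau> (\<tau> x)) \<noteq> {}"
        using d2 card_outs_le[OF finite_R2, of E "\<tau> (\<tau> x)"] by (auto simp: deg_def)
      ultimately show False using rest_no_detour[OF K1(1)] by auto
    qed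
  qed
qed

lemma in_alternate:
  assumes "y \<in> K"
  shows "ins E C y \<noteq> {} \<or> ins E C (\<tau> y) \<noteq> {}"
proof -
  interpret D: two_cycles "E\<inverse>" V "rev xs" "rev ys" by (rule dual_two)
  have "\<tau> y \<in> set (rev ys)" using assms nxt_in[OF ys_distinct] by auto
  then show ?thesis using D.out_alternate[of "\<tau> y"] nxt_rev[OF ys_distinct assms] by auto
qed

text \<open>Even if one of the two sets is empty, the other one obeys the bound: the empty set then
  has a nonempty neighbour in the cyclic order, and the path that ends or starts there has just one vertex
  less.\<close>

lemma consecutive_bound:
  assumes "y \<in> K"
  shows "card (ins E C (\<tau> y)) + card (outs E C y) + c \<le> m + 1"
proof -
  have y1: "\<tau> y \<in> K" using assms nxt_in[OF ys_distinct] by blast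
  consider "ins E C (\<tau> y) \<noteq> {}" "outs E C y \<noteq> {}" | "outs E C y = {}" | "ins E C (\<tau> y) = {}" by auto
  then show ?thesis
  proof cases
    case 1 then show ?thesis using bound_all[OF assms] by simp
  next
    case 2
    obtain x where x: "x \<in> K" "\<tau> x = y" using nxt_onto[OF ys_distinct assms] by auto
    then have "outs E C x \<noteq> {}" using out_alternate[OF x(1)] 2 by auto
    moreover from this have "card (outs E C x) \<ge> 1" by (simp add: Suc_leI card_gt_0_iff)
    ultimately show ?thesis using bound_but_one[OF x(1)] x 2 c_le_m
      by (cases "ins E C (\<tau> y) = {}") auto
  next
    case 3
    then have "ins E C (\<tau> (\<tau> y)) \<noteq> {}" using in_alternate[OF y1] by auto
    moreover from this have "card (ins E C (\<tau> (\<tau> y))) \<ge> 1" by (simp add: Suc_leI card_gt_0_iff)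
    ultimately show ?thesis using bound_but_one[OF assms] 3 c_le_m
      by (cases "outs E C y = {}") auto
  qed
qed

text \<open>Summed round the second cycle, the degrees require one unit per vertex more than the
  attachment bounds allow.\<close>

lemma impossible: False
proof -
  have "(\<Sum>y\<in>K. card (ins E C (\<tau> y)) + card (outs E C y) + c) \<le> (\<Sum>y\<in>K. m + 1)"
    by (intro sum_mono consecutive_bound)
  then have u: "(\<Sum>y\<in>K. card (ins E C y)) + (\<Sum>y\<in>K. card (outs E C y)) + c * c \<le> c * (m + 1)"
    using sum_nxt[OF ys_distinct, of "\<lambda>y. card (ins E C y)"] dcycle_card[OF ys]
    by (simp add: sum.distrib)
  have "(\<Sum>y\<in>K. m + card R2 + 2) \<le> (\<Sum>y\<in>K. card (ins E C y) + card (outs E C y) + deg E R2 y + c)"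
    by (intro sum_mono deg_lower)
  then have "c * (m + card R2 + 2) \<le> (\<Sum>y\<in>K. card (ins E C y)) + (\<Sum>y\<in>K. card (outs E C y))
      + (\<Sum>y\<in>K. deg E R2 y) + c * c"
    using dcycle_card[OF ys] by (simp add: sum.distrib)
  then have "c * (m + card R2 + 2) \<le> c * (m + 1) + c * card R2"
    using u rest_few by linarith
  then show False using c_ge2 by (simp add: algebra_simps)
qed

end

text \<open>
  Now a cycle spans the whole rest and contains the exceptional vertex \<open>z\<close>. No degree condition
  is imposed on \<open>z\<close>, so the averaging takes place over the other vertices \<open>ws\<close> in their cyclic order.
  Only the step across \<open>z\<close> loses one unit in the attachment bound, which is harmless once
  \<open>ws\<close> has two elements.
\<close>

locale spanned_rest = longest_cycle +
  fixes ws :: "'a list" and z :: 'a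
  assumes wz: "dcycle E (ws @ [z])" and wz_set: "set (ws @ [z]) = V - set xs"
    and ws_deg: "\<And>y. y \<in> set ws \<Longrightarrow> deg E V y \<ge> card V" and ws_len: "length ws \<ge> 2"
begin

abbreviation "r \<equiv> Suc (length ws)"
abbreviation "\<sigma> \<equiv> nxt ws"

lemma ws_distinct: "distinct ws"
  using dcycle_distinct[OF wz] by simp

lemma dual_spanned: "spanned_rest (E\<inverse>) V (rev xs) (rev ws) z"
proof -
  interpret D: longest_cycle "E\<inverse>" V "rev xs" by (rule dual)
  have "dcycle (E\<inverse>) ([z] @ rev ws)" using wz dcycle_rev[of E "ws @ [z]"] by simp
  then show ?thesis
    using wz_set ws_deg ws_len by unfold_locales (auto intro: dcycle_append_swap)
qed

lemma r_le_m: "r \<le> m"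
  using longest[OF wz] wz_set by auto

lemma card_rest: "card R = r"
  using dcycle_card[OF wz] wz_set by simp

lemma spanned_deg_lower:
  assumes "y \<in> set ws"
  shows "card (ins E C y) + card (outs E C y) + r \<ge> m + 2"
proof -
  have "deg E V y = deg E C y + deg E R y" by (rule deg_split[OF finite_V cycle_in])
  moreover have "deg E R y + 2 \<le> 2 * r"
    using deg_le_irrefl[of R E y] irrefl assms wz_set finite_V card_rest by auto
  ultimately show ?thesis using ws_deg[OF assms] card_V card_rest by (simp add: deg_def)
qed

text \<open>In the cyclic order of \<open>ws\<close> one can walk from the successor of \<open>y\<close> round to \<open>y\<close>; the walk
  picks up \<open>z\<close> unless it starts at the head of \<open>ws\<close>.\<close>

lemma spanned_path:
  assumes "y \<in> set ws"
  obtains P where "dpath E P" "set P \<subseteq> R" "hd P = \<sigma> y" "last P = y"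
    "length P + of_bool (\<sigma> y = hd ws) = r"
proof -
  obtain i where i: "i < length ws" "ws ! i = y" using assms by (auto simp: in_set_conv_nth)
  have ne: "ws \<noteq> []" using ws_len by auto
  show ?thesis
  proof (cases "Suc i = length ws")
    case True
    then have "\<sigma> y = hd ws" using nxt_nth[OF ws_distinct i(1)] i ne by (simp add: hd_conv_nth)
    moreover have "last ws = y" using True i ne by (metis diff_Suc_1 last_conv_nth)
    moreover have "dpath E ws" using wz ne by (simp add: dcycle_def dpath_append)
    ultimately show ?thesis using that[of ws] wz_set by auto
  next
    case False
    then have s: "\<sigma> y = ws ! Suc i" using nxt_nth[OF ws_distinct i(1)] i by simp
    then have nh: "\<sigma> y \<noteq> hd ws" using ws_distinct i False ne
      by (simp add: hd_conv_nth nth_eq_iff_index_eq)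
    define P where "P = (drop (Suc i) ws @ [z]) @ take (Suc i) ws"
    have "dcycle E (take (Suc i) ws @ (drop (Suc i) ws @ [z]))"
      using wz by (metis append.assoc append_take_drop_id)
    then have "dcycle E P" unfolding P_def by (rule dcycle_append_swap)
    moreover have "hd P = \<sigma> y" using s i False by (simp add: P_def hd_append hd_drop_conv_nth)
    moreover have "last P = y" using i by (simp add: P_def take_Suc_conv_app_nth)
    moreover have "set P \<subseteq> R" using wz_set by (auto simp: P_def dest: in_set_takeD in_set_dropD)
    moreover have "length P = r" using i by (simp add: P_def)
    ultimately show ?thesis using that[of P] nh by (simp add: dcycle_def)
  qed
qed

lemma spanned_bound:
  assumes "y \<in> set ws" "ins E C (\<sigma> y) \<noteq> {}" "outs E C y \<noteq> {}"
  shows "card (ins E C (\<sigma> y)) + card (outs E C y) + r \<le> m + 1 + of_bool (\<sigma> y = hd ws)"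
proof -
  obtain P where P: "dpath E P" "set P \<subseteq> R" "hd P = \<sigma> y" "last P = y"
    "length P + of_bool (\<sigma> y = hd ws) = r" using spanned_path[OF assms(1)] .
  then show ?thesis using attachment_bound[of P] assms by simp
qed

lemma outs_nonempty:
  assumes "y \<in> set ws"
  shows "outs E C y \<noteq> {}"
proof (cases "\<exists>y0\<in>set ws. outs E C y0 \<noteq> {}")
  case True
  then obtain y0 where y0: "y0 \<in> set ws" "outs E C y0 \<noteq> {}" by auto
  show ?thesis
  proof (rule nxt_invariant[where Q = "\<lambda>y. outs E C y \<noteq> {}", OF ws_distinct y0 _ assms])
    fix x assume x: "x \<in> set ws" "outs E C x \<noteq> {}"
    have sx: "\<sigma> x \<in> set ws" using x nxt_in[OF ws_distinct] by blast
    show "outs E C (\<sigma> x) \<noteq> {}"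
    proof
      assume e: "outs E C (\<sigma> x) = {}"
      then have l: "card (ins E C (\<sigma> x)) + r \<ge> m + 2" using spanned_deg_lower[OF sx] by simp
      then have "ins E C (\<sigma> x) \<noteq> {}" using r_le_m by auto
      moreover have "card (outs E C x) \<ge> 1" using x by (simp add: Suc_leI card_gt_0_iff)
      ultimately have "of_bool (\<sigma> x = hd ws) = (1::nat)" "card (ins E C (\<sigma> x)) + r + 1 \<le> m + 2"
        using spanned_bound[OF x(1) _ x(2)] l by (cases "\<sigma> x = hd ws"; simp)+
      then show False using l by simp
    qed
  qed
next
  case False
  have ne: "ws \<noteq> []" using ws_len by auto
  have "outs E C z \<noteq> {}"
  proof
    assume "outs E C z = {}"
    then have no: "outs E C y = {}" if "y \<in> R" for y using that False wz_set by auto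
    have "R \<noteq> {}" using wz_set by auto
    then show False
      by (rule leaves_to_cycle[OF subset_refl _ no]) (auto simp: dpath_def)
  qed
  moreover have h: "hd ws \<in> set ws" using ne by simp
  then have l: "card (ins E C (hd ws)) + r \<ge> m + 2" using spanned_deg_lower[OF h] False by auto
  then have "ins E C (hd ws) \<noteq> {}" using r_le_m by auto
  moreover have "dpath E (ws @ [z])" using wz by (simp add: dcycle_def)
  ultimately have "card (ins E C (hd ws)) + card (outs E C z) + r \<le> m + 1"
    using attachment_bound[of "ws @ [z]"] ne wz_set by auto
  then show ?thesis using l by simp
qed

lemma spanned_impossible: False
proof -
  interpret D: spanned_rest "E\<inverse>" V "rev xs" "rev ws" z by (rule dual_spanned)
  have o: "outs E C y \<noteq> {}" "ins E C y \<noteq> {}" if "y \<in> set ws" for y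
    using outs_nonempty[OF that] D.outs_nonempty[of y] that by auto
  have "hd ws \<in> set ws" using ws_len by (cases ws) auto
  then obtain w where w: "w \<in> set ws" "\<sigma> w = hd ws" using nxt_onto[OF ws_distinct] by blast
  have inj: "inj_on \<sigma> (set ws)" using nxt_bij[OF ws_distinct] by (simp add: bij_betw_def)
  have "(\<Sum>y\<in>set ws. card (ins E C (\<sigma> y)) + card (outs E C y) + r)
      \<le> (\<Sum>y\<in>set ws. m + 1 + of_bool (\<sigma> y = hd ws))"
    using o nxt_in[OF ws_distinct] by (intro sum_mono spanned_bound) auto
  also have "\<dots> = (\<Sum>y\<in>set ws. m + 1 + of_bool (y = w))"
  proof (intro sum.cong refl)
    fix y assume "y \<in> set ws"
    then have "\<sigma> y = hd ws \<longleftrightarrow> y = w" using w inj by (metis inj_on_eq_iff)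
    then show "m + 1 + of_bool (\<sigma> y = hd ws) = m + 1 + of_bool (y = w)" by simp
  qed
  also have "\<dots> = length ws * (m + 1) + 1"
    using w by (simp only: sum.distrib) (simp add: of_bool_def distinct_card[OF ws_distinct])
  finally have u: "(\<Sum>y\<in>set ws. card (ins E C y)) + (\<Sum>y\<in>set ws. card (outs E C y)) + length ws * r
     \<le> length ws * (m + 1) + 1"
    using sum_nxt[OF ws_distinct, of "\<lambda>y. card (ins E C y)"] distinct_card[OF ws_distinct]
    unfolding sum.distrib by simp
  have "(\<Sum>y\<in>set ws. m + 2) \<le> (\<Sum>y\<in>set ws. card (ins E C y) + card (outs E C y) + r)"
    by (intro sum_mono spanned_deg_lower)
  then have "length ws * (m + 2) \<le> length ws * (m + 1) + 1"
    using u distinct_card[OF ws_distinct] unfolding sum.distrib by simp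
  then show False using ws_len by (simp add: algebra_simps)
qed

end

section \<open>Longest cycles when all but one vertex have large degree\<close>

text \<open>Take a vertex of \<open>N\<close> with the fewest ancestors: its ancestors all reach one another.\<close>

lemma initial_component:
  assumes "finite R" "N \<subseteq> R" "N \<noteq> {}" and closed: "\<And>v w. v \<in> N \<Longrightarrow> w \<in> R \<Longrightarrow> (w, v) \<in> E \<Longrightarrow> w \<in> N"
  obtains A where "A \<subseteq> N" "A \<noteq> {}" "strong_on E A" "\<And>v w. v \<in> A \<Longrightarrow> w \<in> R - A \<Longrightarrow> (w, v) \<notin> E"
proof -
  define anc where "anc v = {w \<in> N. (w, v) \<in> (E \<inter> N \<times> N)\<^sup>*}" for v
  obtain v where v: "v \<in> N" "\<And>w. w \<in> N \<Longrightarrow> card (anc v) \<le> card (anc w)"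
    using ex_has_least_nat[of "\<lambda>v. v \<in> N" _ "\<lambda>v. card (anc v)"] assms(3) by blast
  have fin: "finite (anc w)" for w using assms by (auto simp: anc_def intro: finite_subset)
  have returns: "(v, w) \<in> (E \<inter> N \<times> N)\<^sup>*" if "w \<in> anc v" for w
  proof -
    have "anc w \<subseteq> anc v" using that by (auto simp: anc_def)
    moreover have "card (anc v) \<le> card (anc w)" using v that by (auto simp: anc_def)
    ultimately have "anc w = anc v" using fin by (metis card_seteq)
    moreover have "v \<in> anc v" using v by (auto simp: anc_def)
    ultimately show ?thesis by (auto simp: anc_def)
  qed
  have stay: "(x, y) \<in> (E \<inter> anc v \<times> anc v)\<^sup>*" if "(x, y) \<in> (E \<inter> N \<times> N)\<^sup>*" "y \<in> anc v" for x y
  proof -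
    have "x \<in> anc v \<and> (x, y) \<in> (E \<inter> anc v \<times> anc v)\<^sup>*"
      using that(1)
    proof (induction rule: converse_rtrancl_induct)
      case base then show ?case using that by auto
    next
      case (step x x')
      then have "x \<in> anc v" by (auto simp: anc_def intro: converse_rtrancl_into_rtrancl)
      then show ?case using step by (auto intro: converse_rtrancl_into_rtrancl)
    qed
    then show ?thesis by simp
  qed
  have "strong_on E (anc v)" unfolding strong_on_def
  proof (intro ballI)
    fix x y assume "x \<in> anc v" "y \<in> anc v"
    then have "(x, y) \<in> (E \<inter> N \<times> N)\<^sup>*" using returns[of y] by (auto simp: anc_def)
    then show "(x, y) \<in> (E \<inter> anc v \<times> anc v)\<^sup>*" using stay \<open>y \<in> anc v\<close> by blast
  qed
  moreover have "(w, u) \<notin> E" if "u \<in> anc v" "w \<in> R - anc v" for u w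
  proof
    assume "(w, u) \<in> E"
    then have "w \<in> N" using closed that by (auto simp: anc_def)
    then have "w \<in> anc v" using that \<open>(w, u) \<in> E\<close>
      by (auto simp: anc_def intro: converse_rtrancl_into_rtrancl)
    then show False using that by simp
  qed
  moreover have "v \<in> anc v" using v by (auto simp: anc_def)
  ultimately show ?thesis using that[of "anc v"] by (auto simp: anc_def)
qed

lemma strong_or_component:
  assumes "finite R" "R \<noteq> {}"
  obtains (strong) "strong_on E R" "z \<in> R"
  | (initial) A where "A \<subseteq> R" "A \<noteq> {}" "z \<notin> A" "strong_on E A" "\<And>v w. v \<in> A \<Longrightarrow> w \<in> R - A \<Longrightarrow> (w, v) \<notin> E"
  | (final) A where "A \<subseteq> R" "A \<noteq> {}" "z \<notin> A" "strong_on E A" "\<And>v w. v \<in> A \<Longrightarrow> w \<in> R - A \<Longrightarrow> (v, w) \<notin> E"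
proof -
  define N1 where "N1 = {v \<in> R. \<not> (z \<in> R \<and> (z, v) \<in> (E \<inter> R \<times> R)\<^sup>*)}"
  define N2 where "N2 = {v \<in> R. \<not> (z \<in> R \<and> (v, z) \<in> (E \<inter> R \<times> R)\<^sup>*)}"
  show ?thesis
  proof (cases "N1 = {}")
    case False
    have "w \<in> N1" if "v \<in> N1" "w \<in> R" "(w, v) \<in> E" for v w
      using that by (auto simp: N1_def intro: rtrancl_into_rtrancl)
    then obtain A where "A \<subseteq> N1" "A \<noteq> {}" "strong_on E A" "\<And>v w. v \<in> A \<Longrightarrow> w \<in> R - A \<Longrightarrow> (w, v) \<notin> E"
      using initial_component[OF assms(1) _ False, of E] by (auto simp: N1_def)
    then show ?thesis by (intro initial[of A]) (auto simp: N1_def)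
  next
    case N1: True
    show ?thesis
    proof (cases "N2 = {}")
      case False
      have "w \<in> N2" if "v \<in> N2" "w \<in> R" "(w, v) \<in> E\<inverse>" for v w
        using that by (auto simp: N2_def intro: converse_rtrancl_into_rtrancl)
      then obtain A where "A \<subseteq> N2" "A \<noteq> {}" "strong_on (E\<inverse>) A" "\<And>v w. v \<in> A \<Longrightarrow> w \<in> R - A \<Longrightarrow> (w, v) \<notin> E\<inverse>"
        using initial_component[OF assms(1) _ False, of "E\<inverse>"] by (auto simp: N2_def)
      then show ?thesis by (intro final[of A]) (auto simp: N2_def)
    next
      case True
      then have "z \<in> R" using assms by (auto simp: N2_def)
      moreover have "strong_on E R" unfolding strong_on_def
      proof (intro ballI)
        fix x y assume "x \<in> R" "y \<in> R"
        then have "(x, z) \<in> (E \<inter> R \<times> R)\<^sup>*" "(z, y) \<in> (E \<inter> R \<times> R)\<^sup>*"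
          using True N1 by (auto simp: N1_def N2_def)
        then show "(x, y) \<in> (E \<inter> R \<times> R)\<^sup>*" by simp
      qed
      ultimately show ?thesis by (intro strong)
    qed
  qed
qed

lemma longest_cycle_exists:
  assumes "finite V" "irrefl E" "strong_on E V" "dcycle E ys" "set ys \<subseteq> V"
  obtains xs where "longest_cycle E V xs"
proof -
  let ?Q = "\<lambda>zs. dcycle E zs \<and> set zs \<subseteq> V"
  have "length zs < Suc (card V)" if "?Q zs" for zs
    using that dcycle_card[of E zs] card_mono[OF assms(1), of "set zs"] by auto
  then obtain xs where "?Q xs" "\<And>zs. ?Q zs \<Longrightarrow> length zs \<le> length xs"
    using ex_has_greatest_nat[of ?Q ys length] assms by blast
  then show ?thesis using that[of xs] assms by (auto simp: longest_cycle_def)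
qed

context longest_cycle
begin

lemma no_spanned_initial_part:
  assumes "A \<subseteq> R" "\<And>v w. v \<in> A \<Longrightarrow> w \<in> R - A \<Longrightarrow> (w, v) \<notin> E"
    and "\<And>v. v \<in> A \<Longrightarrow> deg E V v \<ge> card V" and "dcycle E ys" "set ys = A"
  shows False
proof -
  have ins0: "ins E (R - A) v = {}" if "v \<in> A" for v using assms(2) that by (auto simp: ins_def)
  have "(\<Sum>y\<in>A. deg E (R - A) y) \<le> (\<Sum>y\<in>A. card (R - A))"
    using ins0 card_outs_le[of "R - A" E] finite_V by (intro sum_mono) (auto simp: deg_def)
  then have few: "(\<Sum>y\<in>A. deg E (R - A) y) \<le> length ys * card (R - A)"
    using dcycle_card[OF assms(4)] assms(5) by simp
  have "nxt ys y \<in> A" if "y \<in> A" for y using that nxt_in dcycle_distinct assms by metis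
  then interpret two_cycles E V xs ys
    using assms few ins0 by unfold_locales auto
  show False by (rule impossible)
qed

lemma deg_initial_part:
  assumes "A \<subseteq> R" "v \<in> A" "\<And>w. w \<in> R - A \<Longrightarrow> (w, v) \<notin> E" "deg E V v \<ge> card V"
  shows "deg E A v \<ge> card A"
proof -
  have "deg E R v \<ge> card R" using assms deg_rest_ge by blast
  moreover have "deg E R v = deg E A v + deg E (R - A) v" 
    by (rule deg_split[OF _ assms(1)]) (simp add: finite_V)
  moreover have "ins E (R - A) v = {}" using assms(3) by (auto simp: ins_def)
  then have "deg E (R - A) v \<le> card (R - A)" using card_outs_le[of "R - A" E v] finite_V
    by (simp add: deg_def)
  moreover have "card R = card A + card (R - A)" using assms(1) finite_V
    by (metis card_Diff_subset card_mono finite_Diff finite_subset le_add_diff_inverse)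
  ultimately show ?thesis by linarith
qed

lemma no_strong_spanned_part:
  assumes ys: "longest_cycle E (V - set xs) ys"
    and z: "z \<notin> set ys" "\<And>v. v \<in> V - {z} \<Longrightarrow> deg E V v \<ge> card V"
    and st: "strong_on E (V - set xs - set ys)"
  shows False
proof -
  interpret L: longest_cycle E "V - set xs" ys by (rule ys)
  let ?R2 = "V - set xs - set ys"
  have "(\<Sum>y\<in>set ys. deg E ?R2 y) = (\<Sum>v\<in>?R2. deg E (set ys) v)"
    using finite_V by (intro sum_deg_swap) auto
  also have "\<dots> \<le> (\<Sum>v\<in>?R2. length ys)" by (intro sum_mono L.deg_cycle_le)
  finally have few: "(\<Sum>y\<in>set ys. deg E ?R2 y) \<le> length ys * card ?R2" by (simp add: mult.commute)
  have nod: "outs E ?R2 y = {} \<or> ins E ?R2 (nxt ys y) = {}" if "y \<in> set ys" for y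
  proof (rule ccontr)
    assume "\<not> ?thesis"
    then obtain v w where vw: "v \<in> ?R2" "(y, v) \<in> E" "w \<in> ?R2" "(w, nxt ys y) \<in> E"
      by (auto simp: outs_def ins_def)
    obtain P where P: "dpath E P" "set P \<subseteq> ?R2" "hd P = v" "last P = w"
      using strong_on_path[OF st, of v w] vw by auto
    have "P \<noteq> []" using P by (auto simp: dpath_def)
    then have "(nxt ys ^^ 1) y \<notin> outs E (set ys) (last P)"
      using P vw that dcycle_not_empty[OF L.cycle]
      by (intro L.no_detour) (auto simp: ins_def Suc_leI)
    then show False using P vw nxt_in[OF dcycle_distinct[OF L.cycle] that] by (simp add: outs_def)
  qed
  interpret two_cycles E V xs ys
    using L.cycle L.cycle_in z few nod by unfold_locales auto
  show False by (rule impossible)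
qed

end

text \<open>If every vertex qualifies as the exceptional one, choosing it on the cycle shows that
  nothing is missed.\<close>

lemma spanning_if_every_exception:
  assumes "longest_cycle E V xs"
    and "\<And>z. z \<in> V \<Longrightarrow> V - set xs = {} \<or> V - set xs = {z} \<or> (\<exists>u. V - set xs = {u, z})"
  shows "set xs = V"
proof -
  interpret longest_cycle E V xs by (rule assms(1))
  obtain a where "a \<in> set xs" using dcycle_not_empty[OF cycle] by (cases xs) auto
  then show ?thesis using assms(2)[of a] cycle_in by auto
qed

text \<open>
  A strengthening of the theorem of Ghouila-Houri. The digraph off a longest cycle inherits the degree
  condition, so by induction a strong component of it without \<open>z\<close> is spanned by a cycle. Such a component can
  be neither initial nor final, which forces the rest to be strong and to contain \<open>z\<close>. By induction
  again, a longest cycle of the rest misses at most \<open>z\<close> and one further vertex, and it can miss nothing.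
\<close>

theorem longest_cycle_one_exception:
  assumes "longest_cycle E V xs" "z \<in> V" "\<And>x. x \<in> V - {z} \<Longrightarrow> deg E V x \<ge> card V"
  shows "V - set xs = {} \<or> V - set xs = {z} \<or>
    (\<exists>u. u \<noteq> z \<and> V - set xs = {u, z} \<and> (u, z) \<in> E \<and> (z, u) \<in> E)"
  using assms
proof (induction "card V" arbitrary: V xs z rule: less_induct)
  case less
  interpret longest_cycle E V xs by (rule less.prems)
  have small: "card B < card V" if "B \<subseteq> R" for B
  proof -
    have "B \<subset> V" using that cycle_in dcycle_not_empty[OF cycle] by (cases xs) auto
    then show ?thesis using finite_V by (intro psubset_card_mono)
  qed
  have ham: "\<exists>ys. dcycle E ys \<and> set ys = A"
    if A: "A \<subseteq> R" "strong_on E A" "A \<noteq> {}" "\<And>v. v \<in> A \<Longrightarrow> deg E A v \<ge> card A" for A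
  proof -
    have fA: "finite A" using A(1) finite_V by (auto intro: finite_subset)
    obtain a where a: "a \<in> A" using A by auto
    have "card A \<ge> 2" using deg_le_irrefl[OF fA irrefl a] A(4)[OF a] by linarith
    then have "\<not> A \<subseteq> {a}" using card_mono[of "{a}" A] by auto
    then obtain b where b: "b \<in> A" "b \<noteq> a" by auto
    obtain ys0 where "dcycle E ys0" "set ys0 \<subseteq> A" using strong_on_cycle[OF irrefl A(2) b(1) a b(2)] by auto
    then obtain ys where ys: "longest_cycle E A ys" using longest_cycle_exists[OF fA irrefl A(2)] by metis
    have "set ys = A"
    proof (rule spanning_if_every_exception[OF ys])
      fix z' assume "z' \<in> A"
      then show "A - set ys = {} \<or> A - set ys = {z'} \<or> (\<exists>u. A - set ys = {u, z'})"
        using less.hyps[OF small[OF A(1)] ys, of z'] A(4) by blast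
    qed
    moreover have "dcycle E ys" using ys by (simp add: longest_cycle_def)
    ultimately show ?thesis by auto
  qed
  show ?case
  proof (cases "R = {}")
    case True then show ?thesis by simp
  next
    case False
    have fR: "finite R" using finite_V by simp
    show ?thesis
    proof (cases rule: strong_or_component[OF fR False, of E z, case_names strong initial final])
      case (initial A)
      have dA: "deg E V v \<ge> card V" if "v \<in> A" for v using less.prems(3) that initial by blast
      have "deg E A v \<ge> card A" if "v \<in> A" for v
        by (rule deg_initial_part[OF initial(1) that initial(5)[OF that] dA[OF that]])
      then obtain ys where ys: "dcycle E ys" "set ys = A" using ham[OF initial(1,4,2)] by metis
      have False by (rule no_spanned_initial_part[OF initial(1) initial(5) dA ys])
      then show ?thesis ..
    next
      case (final A)
      interpret D: longest_cycle "E\<inverse>" V "rev xs" by (rule dual)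
      have dA: "deg E V v \<ge> card V" if "v \<in> A" for v using less.prems(3) that final by blast
      have ini: "(w, v) \<notin> E\<inverse>" if "v \<in> A" "w \<in> V - set (rev xs) - A" for v w
        using final(5) that by auto
      have AR: "A \<subseteq> V - set (rev xs)" using final(1) by simp
      have "deg E A v \<ge> card A" if "v \<in> A" for v
        using D.deg_initial_part[OF AR that] ini[OF that] dA[OF that] by simp
      then obtain ys where "dcycle E ys" "set ys = A" using ham[OF final(1,4,2)] by metis
      then have ys: "dcycle (E\<inverse>) (rev ys)" "set (rev ys) = A" by (auto simp: dcycle_rev)
      have dA': "deg (E\<inverse>) V v \<ge> card V" if "v \<in> A" for v using dA[OF that] by simp
      have False by (rule D.no_spanned_initial_part[OF AR ini dA' ys])
      then show ?thesis ..
    next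
      case strong
      show ?thesis
      proof (cases "R = {z}")
        case False
        then obtain b where b: "b \<in> R" "b \<noteq> z" using strong by auto
        obtain ys0 where "dcycle E ys0" "set ys0 \<subseteq> R"
          using strong_on_cycle[OF irrefl strong(1) b(1) strong(2) b(2)] by auto
        then obtain ys where ys: "longest_cycle E R ys"
          using longest_cycle_exists[OF fR irrefl strong(1)] by metis
        have degR: "deg E R x \<ge> card R" if "x \<in> R - {z}" for x
          using that deg_rest_ge[of x] less.prems(3) by blast
        consider (all) "R - set ys = {}" | (z) "R - set ys = {z}"
          | (uz) u where "u \<noteq> z" "R - set ys = {u, z}" "(u, z) \<in> E" "(z, u) \<in> E"
          using less.hyps[OF small[OF subset_refl] ys strong(2) degR] by blast
        then show ?thesis
        proof cases
          case all
          then have sy: "set ys = R" "dcycle E ys" using ys by (auto simp: longest_cycle_def)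
          then obtain zs where zs: "dcycle E zs" "set zs = R" "last zs = z" "length zs = length ys"
            using dcycle_rotate[OF sy(2), of z] strong(2) by metis
          define ws where "ws = butlast zs"
          have wz: "zs = ws @ [z]" using zs dcycle_not_empty[OF zs(1)]
            by (metis append_butlast_last_id ws_def)
          have zw: "z \<notin> set ws" using dcycle_distinct[OF zs(1)] wz by simp
          show ?thesis
          proof (cases "length ws \<ge> 2")
            case True
            then interpret spanned_rest E V xs ws z
              using zs wz zw less.prems(3) by unfold_locales auto
            show ?thesis using spanned_impossible by simp
          next
            case False
            moreover have "length ws + 1 \<ge> 2" using dcycle_ge2[OF irrefl zs(1)] wz by simp
            ultimately have "length ws = 1" by simp
            then obtain u where "ws = [u]" by (metis One_nat_def length_0_conv length_Suc_conv)
            then have "u \<noteq> z" "R = {u, z}" "(u, z) \<in> E" "(z, u) \<in> E"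
              using zs wz zw by (auto simp: dcycle_def dpath_def)
            then show ?thesis by blast
          qed
        next
          case z
          then have "strong_on E (R - set ys)" by (simp add: strong_on_def)
          moreover have "z \<notin> set ys" using z by auto
          ultimately show ?thesis using no_strong_spanned_part[OF ys _ less.prems(3)] by blast
        next
          case uz
          have "(u, z) \<in> E \<inter> {u, z} \<times> {u, z}" "(z, u) \<in> E \<inter> {u, z} \<times> {u, z}" using uz by auto
          then have "strong_on E (R - set ys)" unfolding uz(2) strong_on_def by blast
          moreover have "z \<notin> set ys" using uz by auto
          ultimately show ?thesis using no_strong_spanned_part[OF ys _ less.prems(3)] by blast
        qed
      qed simp
    qed
  qed
qed

corollary ghouila_houri:
  assumes "finite V" "irrefl E" "strong_on E V" "card V \<ge> 2" "\<And>x. x \<in> V \<Longrightarrow> deg E V x \<ge> card V"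
  obtains xs where "dcycle E xs" "set xs = V"
proof -
  obtain a b where "a \<in> V" "b \<in> V" "a \<noteq> b" using assms(1,4)
    by (metis card_le_Suc0_iff_eq numeral_2_eq_2 not_less_eq_eq)
  then obtain ys where "dcycle E ys" "set ys \<subseteq> V" using strong_on_cycle[OF assms(2,3)] by metis
  then obtain xs where xs: "longest_cycle E V xs" using longest_cycle_exists[OF assms(1-3)] by metis
  have "set xs = V"
    using longest_cycle_one_exception[OF xs] assms(5) by (intro spanning_if_every_exception[OF xs]) blast
  then show ?thesis using that[of xs] xs by (simp add: longest_cycle_def)
qed

section \<open>Hamiltonian digraphs\<close>

definition bypass :: "('a \<times> 'a) set \<Rightarrow> 'a set \<Rightarrow> bool" where
  "bypass E V \<longleftrightarrow> (\<exists>P. dpath E P \<and> set P = V \<and> (hd P, last P) \<in> E)"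

text \<open>The pairs of consecutive vertices of a list, that is, the slots into which a vertex can be
  inserted.\<close>

definition adj :: "'a list \<Rightarrow> ('a \<times> 'a) set" where
  "adj w = set (zip w (tl w))"

lemma adj_single [simp]: "adj [a] = {}"
  by (simp add: adj_def)

lemma adj_Cons: "w \<noteq> [] \<Longrightarrow> adj (a # w) = insert (a, hd w) (adj w)"
  by (cases w) (auto simp: adj_def)

lemma adj_append:
  "v \<noteq> [] \<Longrightarrow> w \<noteq> [] \<Longrightarrow> adj (v @ w) = insert (last v, hd w) (adj v \<union> adj w)"
proof (induction v)
  case (Cons a v)
  then show ?case by (cases "v = []") (auto simp: adj_Cons)
qed simp

lemma adj_split:
  "(a, b) \<in> adj w \<Longrightarrow> \<exists>u v. w = u @ v \<and> u \<noteq> [] \<and> v \<noteq> [] \<and> last u = a \<and> hd v = b"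
proof (induction w)
  case (Cons x w)
  show ?case
  proof (cases "w = []")
    case False
    with Cons.prems have "(a, b) = (x, hd w) \<or> (a, b) \<in> adj w" by (auto simp: adj_Cons)
    then show ?thesis
    proof
      assume "(a, b) = (x, hd w)"
      then show ?thesis using False by (intro exI[of _ "[x]"] exI[of _ w]) auto
    next
      assume "(a, b) \<in> adj w"
      then obtain u v where "w = u @ v \<and> u \<noteq> [] \<and> v \<noteq> [] \<and> last u = a \<and> hd v = b"
        using Cons.IH by blast
      then show ?thesis by (intro exI[of _ "x # u"] exI[of _ v]) auto
    qed
  qed (use Cons in simp)
qed (simp add: adj_def)

lemma deg_single: "deg E {w} y = of_bool ((y, w) \<in> E) + of_bool ((w, y) \<in> E)"
proof -
  have "outs E {w} y = (if (y, w) \<in> E then {w} else {})" "ins E {w} y = (if (w, y) \<in> E then {w} else {})"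
    by (auto simp: outs_def ins_def)
  then show ?thesis by (simp add: deg_def)
qed

lemma deg_insert: "finite S \<Longrightarrow> w \<notin> S \<Longrightarrow> deg E (insert w S) y = deg E {w} y + deg E S y"
  using deg_Un[of "{w}" S E y] by simp

text \<open>Without a usable slot, at each consecutive pair \<open>a\<close>, \<open>b\<close> at most one of the arcs \<open>a y\<close> and \<open>y b\<close>
  is present; only the in-arc from the last and the out-arc to the first vertex are not paired up.\<close>

lemma deg_no_slot:
  assumes "w \<noteq> []" "distinct w" "\<And>a b. (a, b) \<in> adj w \<Longrightarrow> (a, y) \<in> E \<Longrightarrow> (y, b) \<in> E \<Longrightarrow> False"
  shows "deg E (set w) y + 1 \<le> length w + of_bool ((last w, y) \<in> E) + of_bool ((y, hd w) \<in> E)"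
  using assms
proof (induction w)
  case (Cons a w)
  show ?case
  proof (cases "w = []")
    case True then show ?thesis by (simp add: deg_single)
  next
    case False
    have "deg E (set w) y + 1 \<le> length w + of_bool ((last w, y) \<in> E) + of_bool ((y, hd w) \<in> E)"
      using Cons.prems False by (intro Cons.IH) (auto simp: adj_Cons)
    moreover have "of_bool ((a, y) \<in> E) + of_bool ((y, hd w) \<in> E) \<le> (1::nat)"
    proof -
      have "(a, hd w) \<in> adj (a # w)" using False by (simp add: adj_Cons)
      then show ?thesis using Cons.prems(3) by auto
    qed
    moreover have "deg E (set (a # w)) y = deg E {a} y + deg E (set w) y"
      using Cons.prems(2) deg_insert[of "set w" a E y] by simp
    ultimately have "deg E (set (a # w)) y + 1
        \<le> Suc (length w) + of_bool ((last w, y) \<in> E) + of_bool ((y, a) \<in> E)"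
      unfolding deg_single by linarith
    then show ?thesis using False by (simp del: of_bool_eq_iff)
  qed
qed simp

text \<open>
  Vertices that can be inserted one at a time can be inserted simultaneously if they form a path.
  Insert a maximal initial stretch of \<open>s\<close> into a slot \<open>(a, b)\<close> of its first vertex, where maximal means that
  no later vertex of \<open>s\<close> dominates \<open>b\<close>. The later vertices then keep their slots, as these are different
  from \<open>(a, b)\<close>.
\<close>

lemma insert_all:
  assumes "dpath E w" "s = [] \<or> dpath E s" "set s \<inter> set w = {}"
    and "\<And>y. y \<in> set s \<Longrightarrow> \<exists>a b. (a, b) \<in> adj w \<and> (a, y) \<in> E \<and> (y, b) \<in> E"
  shows "\<exists>w'. dpath E w' \<and> set w' = set w \<union> set s \<and> hd w' = hd w \<and> last w' = last w"
  using assms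
proof (induction "length s" arbitrary: s w rule: less_induct)
  case less
  show ?case
  proof (cases s)
    case Nil then show ?thesis using less.prems(1) by auto
  next
    case (Cons y s')
    then obtain a b where ab: "(a, b) \<in> adj w" "(a, y) \<in> E" "(y, b) \<in> E" using less.prems(4)[of y] by auto
    obtain us x vs where s: "s = us @ x # vs" "(x, b) \<in> E" "\<forall>v\<in>set vs. (v, b) \<notin> E"
      using split_list_last_prop[of s "\<lambda>x. (x, b) \<in> E"] ab Cons by auto
    define t where "t = us @ [x]"
    have t: "t \<noteq> []" "s = t @ vs" "last t = x" "hd t = y" using s Cons by (cases us; auto simp: t_def)+
    obtain u v where w: "w = u @ v" "u \<noteq> []" "v \<noteq> []" "last u = a" "hd v = b" using adj_split[OF ab(1)] by blast
    have dt: "dpath E t" using less.prems(2) t by (cases "vs = []") (auto simp: dpath_append)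
    have duv: "dpath E u" "dpath E v" "set u \<inter> set v = {}" using less.prems(1) w by (auto simp: dpath_append)
    define w1 where "w1 = u @ t @ v"
    have sets: "set t \<inter> set u = {}" "set t \<inter> set v = {}" using less.prems(3) t w by auto
    have dw1: "dpath E w1" unfolding w1_def using w t dt duv ab s sets by (auto simp: dpath_append)
    have "\<exists>w'. dpath E w' \<and> set w' = set w1 \<union> set vs \<and> hd w' = hd w1 \<and> last w' = last w1"
    proof (rule less.hyps)
      show "length vs < length s" using t by simp
      show "dpath E w1" by (rule dw1)
      show "vs = [] \<or> dpath E vs" using less.prems(2) t by (cases "vs = []") (auto simp: dpath_append)
      show "set vs \<inter> set w1 = {}"
        using less.prems(2,3) t w by (auto simp: w1_def dpath_def)
      fix q assume q: "q \<in> set vs"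
      then obtain c d where cd: "(c, d) \<in> adj w" "(c, q) \<in> E" "(q, d) \<in> E" using less.prems(4)[of q] t by auto
      then have "d \<noteq> b" using s q by auto
      then have "(c, d) \<in> adj u \<union> adj v" using cd(1) w by (auto simp: adj_append)
      then have "(c, d) \<in> adj w1" using w t by (auto simp: w1_def adj_append)
      then show "\<exists>c d. (c, d) \<in> adj w1 \<and> (c, q) \<in> E \<and> (q, d) \<in> E" using cd by blast
    qed
    then show ?thesis using w t by (auto simp: w1_def)
  qed
qed

lemma bypass_consecutive_ins:
  assumes "dcycle E xs" "v \<notin> set xs" "a \<in> set xs" "(a, v) \<in> E" "(nxt xs a, v) \<in> E"
  shows "bypass E (insert v (set xs))"
proof -
  obtain ys where ys: "dcycle E ys" "set ys = set xs" "last ys = a" "hd ys = nxt xs a"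
    using dcycle_rotate[OF assms(1,3)] by metis
  have "ys \<noteq> []" using ys dcycle_not_empty by blast
  then have "dpath E (ys @ [v])" using ys assms by (auto simp: dpath_append dcycle_def)
  then show ?thesis unfolding bypass_def
    using ys assms \<open>ys \<noteq> []\<close> by (intro exI[of _ "ys @ [v]"]) auto
qed

lemma bypass_consecutive_outs:
  assumes "dcycle E xs" "v \<notin> set xs" "a \<in> set xs" "(v, a) \<in> E" "(v, nxt xs a) \<in> E"
  shows "bypass E (insert v (set xs))"
proof -
  obtain ys where ys: "dcycle E ys" "set ys = set xs" "last ys = a" "hd ys = nxt xs a"
    using dcycle_rotate[OF assms(1,3)] by metis
  have "ys \<noteq> []" using ys dcycle_not_empty by blast
  then have "dpath E ([v] @ ys)" using ys assms by (subst dpath_append) (auto simp: dcycle_def)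
  then show ?thesis unfolding bypass_def
    using ys assms \<open>ys \<noteq> []\<close> by (intro exI[of _ "[v] @ ys"]) auto
qed

lemma double_card_le:
  assumes "distinct xs" "S \<subseteq> set xs" "\<And>a. a \<in> S \<Longrightarrow> nxt xs a \<notin> S"
  shows "2 * card S \<le> length xs"
proof -
  have "inj_on (nxt xs) S" using nxt_bij[OF assms(1)] assms(2) by (metis bij_betw_imp_inj_on inj_on_subset)
  then have "card (nxt xs ` S) = card S" by (simp add: card_image)
  moreover have fin: "finite S" using assms(2) finite_subset by blast
  then have "card (S \<union> nxt xs ` S) = card S + card (nxt xs ` S)"
    using assms(3) by (intro card_Un_disjoint) auto
  moreover have "S \<union> nxt xs ` S \<subseteq> set xs" using assms(2) nxt_in[OF assms(1)] by auto
  then have "card (S \<union> nxt xs ` S) \<le> length xs" using card_mono[of "set xs"] distinct_card[OF assms(1)] by fastforce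
  ultimately show ?thesis by simp
qed

lemma deg_self_remove:
  assumes "finite V" "irrefl E" "v \<in> V"
  shows "deg E (V - {v}) v = deg E V v"
proof -
  have "deg E {v} v = 0" using assms(2) by (auto simp: deg_single irrefl_def)
  then show ?thesis using deg_split[OF assms(1), of "{v}" E v] assms(3) by simp
qed

text \<open>The degree of \<open>v\<close> exceeds the length of the cycle, so two consecutive vertices of the cycle
  both dominate \<open>v\<close> or are both dominated by \<open>v\<close>.\<close>

lemma bypass_if_cycle_misses_one:
  assumes "finite V" "irrefl E" "dcycle E xs" "v \<in> V" "set xs = V - {v}" "deg E V v \<ge> card V"
  shows "bypass E V"
proof (rule ccontr)
  assume no: "\<not> bypass E V"
  have d: "distinct xs" using assms dcycle_distinct by blast
  have V: "V = insert v (set xs)" "v \<notin> set xs" using assms by auto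
  have "2 * card (ins E (set xs) v) \<le> length xs"
    using bypass_consecutive_ins[OF assms(3) V(2)] no V(1)
    by (intro double_card_le[OF d]) (auto simp: ins_def)
  moreover have "2 * card (outs E (set xs) v) \<le> length xs"
    using bypass_consecutive_outs[OF assms(3) V(2)] no V(1)
    by (intro double_card_le[OF d]) (auto simp: outs_def)
  ultimately have "deg E (set xs) v \<le> length xs" by (simp add: deg_def)
  moreover have "deg E (set xs) v = deg E V v" using deg_self_remove assms by metis
  moreover have "card V = length xs + 1" using V distinct_card[OF d] by simp
  ultimately show False using assms(6) by simp
qed

text \<open>
  In this locale the exceptional vertex is \<open>hd xs\<close>. The vertices are indexed by \<open>0, \<dots>, p\<close>, and both
  \<open>X 0\<close> and \<open>X p\<close> are the exceptional vertex, so that a stretch \<open>seg i l\<close> with \<open>1 \<le> i\<close> and \<open>i + l \<le> p\<close>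
  never contains it. The list \<open>rest i l\<close> is the complementary path, from \<open>X (i + l)\<close> round to
  \<open>X (i - 1)\<close>.
\<close>

locale ham_cycle_no_bypass =
  fixes E :: "('a \<times> 'a) set" and xs :: "'a list"
  assumes irr: "irrefl E" and cyc: "dcycle E xs" and len: "length xs \<ge> 3"
    and degs: "\<And>x. x \<in> set (tl xs) \<Longrightarrow> deg E (set xs) x \<ge> length xs"
    and no_bypass: "\<not> bypass E (set xs)"
begin

abbreviation "p \<equiv> length xs"
definition "X i = xs ! (i mod p)"
definition "seg i l = take l (drop i xs)"
definition "rest i l = drop (i + l) xs @ take i xs"

lemma dist: "distinct xs"
  using cyc dcycle_distinct by blast

lemma X_less: "i < p \<Longrightarrow> X i = xs ! i"
  by (simp add: X_def)

lemma X_p: "X p = xs ! 0"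
  by (simp add: X_def)

lemma no_reverse:
  assumes "k < p" shows "(X (k + 1), X k) \<notin> E"
proof
  assume e: "(X (k + 1), X k) \<in> E"
  have "X k \<in> set xs" using assms by (simp add: X_less)
  moreover have "nxt xs (X k) = X (k + 1)" using nxt_nth[OF dist assms] assms by (simp add: X_def)
  ultimately obtain ys where "dcycle E ys" "set ys = set xs" "last ys = X k" "hd ys = X (k + 1)"
    using dcycle_rotate[OF cyc, of "X k"] by metis
  then have "bypass E (set xs)" using e unfolding bypass_def dcycle_def by auto
  then show False using no_bypass by simp
qed

lemma deg_ge: "1 \<le> j \<Longrightarrow> j < p \<Longrightarrow> deg E (set xs) (xs ! j) \<ge> p"
  using nth_mem[of "j - 1" "tl xs"] by (intro degs) (simp add: nth_tl)

lemma seg_facts: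
  assumes "1 \<le> i" "1 \<le> l" "i + l \<le> p"
  shows "dpath E (rest i l @ seg i l)" "rest i l \<noteq> []" "seg i l \<noteq> []" "length (rest i l) = p - l"
    "length (seg i l) = l" "hd (rest i l) = X (i + l)" "last (rest i l) = X (i - 1)"
    "set (rest i l) \<union> set (seg i l) = set xs"
    "\<And>k. k < l \<Longrightarrow> seg i l ! k = xs ! (i + k)"
proof -
  have x: "xs = (take i xs @ seg i l) @ drop (i + l) xs"
    unfolding seg_def by (metis add.commute append.assoc append_take_drop_id drop_drop)
  then have "dcycle E (drop (i + l) xs @ (take i xs @ seg i l))"
    using dcycle_append_swap[of E "take i xs @ seg i l" "drop (i + l) xs"] cyc by metis
  then show "dpath E (rest i l @ seg i l)" by (simp add: rest_def dcycle_def)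
  have "take i xs \<noteq> []" using assms len by (cases xs) auto
  then show "rest i l \<noteq> []" by (simp add: rest_def)
  show ls: "length (seg i l) = l" using assms by (simp add: seg_def)
  then show "seg i l \<noteq> []" using assms by auto
  show "length (rest i l) = p - l" using assms by (simp add: rest_def)
  show "hd (rest i l) = X (i + l)"
  proof (cases "i + l = p")
    case True
    have "hd (take i xs) = xs ! 0" using assms \<open>take i xs \<noteq> []\<close> by (simp add: hd_conv_nth)
    then show ?thesis using True by (simp add: rest_def X_p)
  next
    case False
    then show ?thesis using assms by (simp add: rest_def hd_append hd_drop_conv_nth X_less)
  qed
  show "last (rest i l) = X (i - 1)"
  proof -
    have "last (rest i l) = last (take i xs)" using \<open>take i xs \<noteq> []\<close> by (simp add: rest_def)
    also have "\<dots> = xs ! (i - 1)"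
      using last_conv_nth[OF \<open>take i xs \<noteq> []\<close>] assms by (simp add: min_def)
    finally show ?thesis using assms by (simp add: X_less)
  qed
  show "set (rest i l) \<union> set (seg i l) = set xs"
    by (subst (3) x) (auto simp: rest_def)
  show "seg i l ! k = xs ! (i + k)" if "k < l" for k using that assms by (simp add: seg_def)
qed

text \<open>Such a chord closes a cycle that misses only \<open>X i\<close>.\<close>

lemma no_skip:
  assumes "1 \<le> i" "i < p" shows "(X (i - 1), X (i + 1)) \<notin> E"
proof
  assume e: "(X (i - 1), X (i + 1)) \<in> E"
  note f = seg_facts[of i 1]
  have s: "seg i 1 = [xs ! i]" using f(5) f(9)[of 0] assms by (cases "seg i 1") auto
  have "dpath E (rest i 1)" "xs ! i \<notin> set (rest i 1)" using f(1,2) assms s by (auto simp: dpath_append)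
  then have "dcycle E (rest i 1)" "set (rest i 1) = set xs - {xs ! i}"
    using f(6,7,8) e s assms by (auto simp: dcycle_def)
  then have "bypass E (set xs)"
    using bypass_if_cycle_misses_one[of "set xs" E "rest i 1" "xs ! i"] irr assms deg_ge[of i] distinct_card[OF dist]
    by simp
  then show False using no_bypass by simp
qed

text \<open>Counting over the whole path of \<open>p - 1\<close> vertices does not suffice. Split off a cycle neighbour of \<open>X i\<close>
  that is not the exceptional vertex; one exists because \<open>p \<ge> 3\<close>. It is joined to \<open>X i\<close> by
  one arc only, and the absence of a chord over it sharpens the count over the other vertices.\<close>

lemma slot_one:
  assumes "1 \<le> i" "i < p"
  shows "\<exists>a b. (a, b) \<in> adj (rest i 1) \<and> (a, xs ! i) \<in> E \<and> (xs ! i, b) \<in> E"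
proof (rule ccontr)
  assume none: "\<not> ?thesis"
  let ?y = "xs ! i"
  note f = seg_facts[of i 1]
  have s: "seg i 1 = [?y]" using f(5) f(9)[of 0] assms by (cases "seg i 1") auto
  have yn: "?y \<notin> set (rest i 1)" "distinct (rest i 1)" using f(1,2) assms s by (auto simp: dpath_append dpath_def)
  have "set xs = insert ?y (set (rest i 1))" using f(8) s assms by auto
  then have dd: "deg E (set (rest i 1)) ?y \<ge> p" using deg_ge[OF assms] deg_insert[of "set (rest i 1)" ?y E ?y] yn irr
    by (simp add: deg_single irrefl_def)
  have lr: "length (rest i 1) = p - 1" using f(4) assms by simp
  show False
  proof (cases "i + 1 < p")
    case True
    define w where "w = tl (rest i 1)"
    have r: "rest i 1 = X (i + 1) # w" using f(2,6) assms by (cases "rest i 1") (auto simp: w_def)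
    have w: "w \<noteq> []" using lr r len by auto
    have "w = drop (i + 2) xs @ take i xs" using True by (simp add: w_def rest_def drop_Suc tl_drop)
    then have "hd w = X (i + 2)" using seg_facts(6)[of i 2] assms True by (simp add: rest_def)
    moreover have "(X i, X (i + 2)) \<notin> E" using no_skip[of "i + 1"] True by simp
    ultimately have h: "(?y, hd w) \<notin> E" using assms by (simp add: X_less)
    have "deg E (set w) ?y + 1 \<le> length w + of_bool ((last w, ?y) \<in> E) + of_bool ((?y, hd w) \<in> E)"
      using none w r yn by (intro deg_no_slot) (auto simp: adj_Cons)
    then have "deg E (set w) ?y \<le> length w" using h by (simp add: of_bool_def split: if_splits)
    moreover have "deg E {X (i + 1)} ?y \<le> 1" using no_reverse[of i] assms by (simp add: deg_single X_less)
    moreover have "deg E (set (rest i 1)) ?y = deg E {X (i + 1)} ?y + deg E (set w) ?y"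
      using r yn(2) deg_insert[of "set w" "X (i + 1)" E ?y] by simp
    ultimately show False using dd r lr len by simp
  next
    case False
    then have i: "i + 1 = p" "i \<ge> 2" using assms len by auto
    define w where "w = butlast (rest i 1)"
    have r: "rest i 1 = w @ [X (i - 1)]" using f(2,7) assms unfolding w_def
      by (metis append_butlast_last_id order_refl Suc_eq_plus1 Suc_leI)
    have w: "w \<noteq> []" using lr r len by auto
    have "w = take (i - 1) xs" using i assms by (simp add: w_def rest_def butlast_take)
    then have "last w = X (i - 2)" using i w by (simp add: last_conv_nth X_less numeral_2_eq_2)
    moreover have "(X (i - 2), X i) \<notin> E" using no_skip[of "i - 1"] i by (simp add: numeral_2_eq_2)
    ultimately have h: "(last w, ?y) \<notin> E" using assms by (simp add: X_less)
    have "deg E (set w) ?y + 1 \<le> length w + of_bool ((last w, ?y) \<in> E) + of_bool ((?y, hd w) \<in> E)"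
      using none w r yn by (intro deg_no_slot) (auto simp: adj_append)
    then have "deg E (set w) ?y \<le> length w" using h by (simp add: of_bool_def split: if_splits)
    moreover have "deg E {X (i - 1)} ?y \<le> 1" using no_reverse[of "i - 1"] assms by (simp add: deg_single X_less)
    moreover have "deg E (set (rest i 1)) ?y = deg E {X (i - 1)} ?y + deg E (set w) ?y"
      using r yn(2) deg_insert[of "set w" "X (i - 1)" E ?y] by simp
    ultimately show False using dd r lr len by simp
  qed
qed

definition "chordless l \<longleftrightarrow> (\<forall>a b. a + 2 \<le> b \<longrightarrow> b \<le> a + l \<longrightarrow> b \<le> p \<longrightarrow> (X a, X b) \<notin> E \<and> (X b, X a) \<notin> E)"

lemma chordlessD:
  assumes "chordless l" "a + 2 \<le> b" "b \<le> a + l" "b \<le> p"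
  shows "(X a, X b) \<notin> E" "(X b, X a) \<notin> E"
  using assms unfolding chordless_def by blast+

text \<open>Inside the stretch a vertex is joined to its two neighbours only, and by one arc each. All
  remaining arcs go to a path of \<open>p - l\<close> vertices, which is too short not to offer a slot.\<close>

lemma slot_long:
  assumes chordless: "chordless l" and il: "1 \<le> i" "2 \<le> l" "i + l \<le> p" and j: "i \<le> j" "j < i + l"
  shows "\<exists>a b. (a, b) \<in> adj (rest i l) \<and> (a, xs ! j) \<in> E \<and> (xs ! j, b) \<in> E"
proof (rule ccontr)
  assume none: "\<not> ?thesis"
  let ?y = "xs ! j"
  have jp: "j < p" using j il by simp
  then have Xj: "X j = ?y" by (simp add: X_less)
  note f = seg_facts[OF il(1) _ il(3)]
  have rs: "set (rest i l) \<inter> set (seg i l) = {}" "distinct (rest i l)"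
    using f(1,2,3) il by (auto simp: dpath_append dpath_def)
  have in_seg: "\<exists>k. i \<le> k \<and> k < i + l \<and> x = X k" if "x \<in> set (seg i l)" for x
  proof -
    obtain k where "k < l" "x = seg i l ! k" using \<open>x \<in> set (seg i l)\<close> f(5) il by (auto simp: in_set_conv_nth)
    then show ?thesis using f(9)[of k] il by (intro exI[of _ "i + k"]) (auto simp: X_less)
  qed
  have "outs E (set (seg i l)) ?y \<subseteq> (if j + 1 < i + l then {X (j + 1)} else {})"
  proof
    fix x assume "x \<in> outs E (set (seg i l)) ?y"
    then obtain k where k: "i \<le> k" "k < i + l" "x = X k" "(X j, X k) \<in> E" using in_seg Xj by (auto simp: outs_def)
    have "k \<noteq> j" using k irr by (auto simp: irrefl_def)
    moreover have "\<not> j + 2 \<le> k" using chordlessD[OF chordless, of j k] k il j by auto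
    moreover have "\<not> k + 2 \<le> j" using chordlessD[OF chordless, of k j] k il j by auto
    moreover have "k + 1 \<noteq> j" using no_reverse[of k] k jp by auto
    ultimately have "k = j + 1" by linarith
    then show "x \<in> (if j + 1 < i + l then {X (j + 1)} else {})" using k by simp
  qed
  then have o: "card (outs E (set (seg i l)) ?y) \<le> of_bool (j + 1 < i + l)"
    using card_mono[of "if j + 1 < i + l then {X (j + 1)} else {}"] by (auto simp: of_bool_def split: if_splits)
  have "ins E (set (seg i l)) ?y \<subseteq> (if i < j then {X (j - 1)} else {})"
  proof
    fix x assume "x \<in> ins E (set (seg i l)) ?y"
    then obtain k where k: "i \<le> k" "k < i + l" "x = X k" "(X k, X j) \<in> E" using in_seg Xj by (auto simp: ins_def)
    have "k \<noteq> j" using k irr by (auto simp: irrefl_def)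
    moreover have "\<not> j + 2 \<le> k" using chordlessD[OF chordless, of j k] k il j by auto
    moreover have "\<not> k + 2 \<le> j" using chordlessD[OF chordless, of k j] k il j by auto
    moreover have "j + 1 \<noteq> k" using no_reverse[of j] k jp by auto
    ultimately have "k + 1 = j" by linarith
    then show "x \<in> (if i < j then {X (j - 1)} else {})" using k by auto
  qed
  then have i: "card (ins E (set (seg i l)) ?y) \<le> of_bool (i < j)"
    using card_mono[of "if i < j then {X (j - 1)} else {}"] by (auto simp: of_bool_def split: if_splits)
  have n: "deg E (set (rest i l)) ?y + 1 \<le> length (rest i l) + of_bool ((last (rest i l), ?y) \<in> E) + of_bool ((?y, hd (rest i l)) \<in> E)"
    using none rs f(2) il by (intro deg_no_slot) auto
  have la: "of_bool ((last (rest i l), ?y) \<in> E) \<le> (of_bool (j = i) :: nat)"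
  proof -
    have "(X (i - 1), X j) \<notin> E" if "j \<noteq> i" using chordlessD[OF chordless, of "i - 1" j] that j il jp by simp
    then show ?thesis using f(7) il Xj by (auto simp: of_bool_def)
  qed
  have he: "of_bool ((?y, hd (rest i l)) \<in> E) \<le> (of_bool (j + 1 = i + l) :: nat)"
  proof -
    have "(X j, X (i + l)) \<notin> E" if "j + 1 \<noteq> i + l" using chordlessD[OF chordless, of j "i + l"] that j il jp by simp
    then show ?thesis using f(6) il Xj by (auto simp: of_bool_def)
  qed
  have "deg E (set xs) ?y = deg E (set (rest i l)) ?y + deg E (set (seg i l)) ?y"
    using f(8) il deg_Un[OF _ _ rs(1), of E ?y] by simp
  moreover have "deg E (set (seg i l)) ?y \<le> of_bool (j + 1 < i + l) + of_bool (i < j)" using o i by (simp add: deg_def)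
  moreover have "deg E (set xs) ?y \<ge> p" using deg_ge[OF _ jp] j il by simp
  moreover have "of_bool (j + 1 < i + l) + of_bool (j + 1 = i + l) = (1::nat)" "of_bool (i < j) + of_bool (j = i) = (1::nat)"
    using j by auto
  moreover have "length (rest i l) + l = p" using f(4) il by simp
  ultimately show False using n la he il(2) by linarith
qed

text \<open>
  Consider a pair \<open>X a\<close>, \<open>X b\<close> at distance \<open>l + 1\<close>, and insert the vertices between them into the
  complementary path. A backward arc turns the resulting Hamiltonian path into a bypass. For a
  forward arc one inserts all but one vertex and obtains a cycle that misses only this vertex.
\<close>

lemma chordless_all: "l \<le> p - 1 \<Longrightarrow> chordless l"
proof (induction l)
  case 0 then show ?case by (simp add: chordless_def)
next
  case (Suc l)
  then have IH: "chordless l" by simp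
  have lp: "Suc l \<le> p - 1" using Suc by simp
  show ?case unfolding chordless_def
  proof (intro allI impI)
    fix a b assume ab: "a + 2 \<le> b" "b \<le> a + Suc l" "b \<le> p"
    show "(X a, X b) \<notin> E \<and> (X b, X a) \<notin> E"
    proof (cases "b \<le> a + l")
      case True then show ?thesis using IH ab unfolding chordless_def by blast
    next
      case False
      define i where "i = a + 1"
      have b: "b = i + l" "a = i - 1" "1 \<le> i" "1 \<le> l" "i + l \<le> p" using False ab by (auto simp: i_def)
      note f = seg_facts[OF b(3,4,5)]
      have slots: "\<exists>a b. (a, b) \<in> adj (rest i l) \<and> (a, y) \<in> E \<and> (y, b) \<in> E" if "y \<in> set (seg i l)" for y
      proof -
        obtain k where k: "k < l" "y = xs ! (i + k)" using \<open>y \<in> set (seg i l)\<close> f(5,9) by (auto simp: in_set_conv_nth)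
        show ?thesis
        proof (cases "l = 1")
          case True then show ?thesis using slot_one[of i] k b by auto
        next
          case False then show ?thesis using slot_long[OF IH b(3) _ b(5), of "i + k"] k b by auto
        qed
      qed
      have dr: "dpath E (rest i l)" "dpath E (seg i l)" "set (seg i l) \<inter> set (rest i l) = {}"
        using f(1,2,3) by (auto simp: dpath_append)
      have "(X b, X a) \<notin> E"
      proof
        assume e: "(X b, X a) \<in> E"
        obtain w where "dpath E w" "set w = set (rest i l) \<union> set (seg i l)" "hd w = hd (rest i l)" "last w = last (rest i l)"
          using insert_all[OF dr(1) _ dr(3) slots] dr(2) by blast
        then have "bypass E (set xs)" using e f(6,7,8) b unfolding bypass_def by auto
        then show False using no_bypass by simp
      qed
      moreover have "(X a, X b) \<notin> E"
      proof
        assume e: "(X a, X b) \<in> E"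
        define s where "s = butlast (seg i l)"
        have sg: "seg i l = s @ [last (seg i l)]" using f(3) by (simp add: s_def)
        have "s = [] \<or> dpath E s" using dr(2) sg by (cases "s = []") (metis dpath_append list.distinct(1))+
        moreover have "set s \<subseteq> set (seg i l)" unfolding s_def by (auto dest: in_set_butlastD)
        ultimately obtain w where w: "dpath E w" "set w = set (rest i l) \<union> set s" "hd w = hd (rest i l)" "last w = last (rest i l)"
          using insert_all[OF dr(1), of s] dr(3) slots by blast
        then have cw: "dcycle E w" using e f(6,7) b by (simp add: dcycle_def)
        define v where "v = last (seg i l)"
        have "v = xs ! (i + l - 1)" using f(3,5) f(9)[of "l - 1"] b by (simp add: v_def last_conv_nth)
        then have dv: "deg E (set xs) v \<ge> p" using deg_ge[of "i + l - 1"] b by simp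
        have "v \<in> set (seg i l)" using f(3) by (simp add: v_def)
        moreover have "v \<notin> set s" using dr(2) sg unfolding v_def dpath_def by (metis distinct_append disjoint_iff list.set_intros(1))
        moreover have "set (seg i l) = insert v (set s)" by (subst sg) (simp add: v_def)
        ultimately have "set w = set xs - {v}" "v \<in> set xs" using w(2) f(8) dr(3) by auto
        then have "bypass E (set xs)" using bypass_if_cycle_misses_one[OF _ irr cw, of "set xs" v] dv distinct_card[OF dist] by simp
        then show False using no_bypass by simp
      qed
      ultimately show ?thesis by simp
    qed
  qed
qed

text \<open>The first arc of the cycle, from \<open>X p = X 0\<close> to \<open>X 1\<close>, joins vertices at distance
  \<open>p - 1\<close>.\<close>

lemma contradictory: False
proof -
  have "chordless (p - 1)" using chordless_all by simp
  then have "(X p, X 1) \<notin> E" using len unfolding chordless_def by simp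
  moreover have "X 1 = xs ! 1" "X p = xs ! 0" using len by (simp_all add: X_def)
  moreover have "0 < p" using len by linarith
  then have "(xs ! 0, xs ! 1) \<in> E"
    using dcycle_arc[OF cyc, of "xs ! 0"] nxt_nth[OF dist, of 0] len by simp
  ultimately show False by simp
qed

end

theorem bypass_if_hamiltonian:
  assumes "irrefl E" "dcycle E xs" "set xs = V" "card V \<ge> 3"
    and "z \<in> V" "\<And>x. x \<in> V - {z} \<Longrightarrow> deg E V x \<ge> card V"
  shows "bypass E V"
proof (rule ccontr)
  assume no: "\<not> bypass E V"
  have d: "distinct xs" using assms dcycle_distinct by blast
  obtain a where "a \<in> set xs" "nxt xs a = z" using nxt_onto[OF d] assms by auto
  then obtain ys where ys: "dcycle E ys" "set ys = set xs" "hd ys = z" using dcycle_rotate[OF assms(2)] by metis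
  have dy: "distinct ys" "ys \<noteq> []" using ys dcycle_distinct dcycle_not_empty by blast+
  then have "z \<notin> set (tl ys)" "set (tl ys) \<subseteq> V" using ys assms by (cases ys; auto)+
  moreover have "length ys = card V" using ys assms dcycle_card by metis
  ultimately interpret ham_cycle_no_bypass E ys
    using assms ys no by unfold_locales auto
  show False by (rule contradictory)
qed

section \<open>Non-Hamiltonian digraphs: the exceptional vertex\<close>

lemma bypass_converse: "bypass (E\<inverse>) V \<Longrightarrow> bypass E V"
  unfolding bypass_def
proof (elim exE conjE)
  fix P assume "dpath (E\<inverse>) P" "set P = V" "(hd P, last P) \<in> E\<inverse>"
  then show "\<exists>P. dpath E P \<and> set P = V \<and> (hd P, last P) \<in> E"
    using dpath_rev[of E "rev P"] by (intro exI[of _ "rev P"]) (auto simp: hd_rev last_rev)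
qed

locale no_ham_no_bypass =
  fixes E :: "('a \<times> 'a) set" and V :: "'a set" and z :: 'a
  assumes finV: "finite V" and irr: "irrefl E" and strongV: "strong_on E V"
    and strong_del: "\<And>v. v \<in> V \<Longrightarrow> strong_on E (V - {v})" and card3: "card V \<ge> 3" and zV: "z \<in> V"
    and degV: "\<And>x. x \<in> V - {z} \<Longrightarrow> deg E V x \<ge> card V"
    and no_ham: "\<And>xs. dcycle E xs \<Longrightarrow> set xs \<noteq> V" and no_bypass: "\<not> bypass E V"
begin

lemma dual_nonham: "no_ham_no_bypass (E\<inverse>) V z"
proof
  fix xs assume "dcycle (E\<inverse>) xs"
  then have "dcycle E (rev xs)" using dcycle_rev[of E "rev xs"] by simp
  then show "set xs \<noteq> V" using no_ham[of "rev xs"] by simp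
next
  show "\<not> bypass (E\<inverse>) V" using bypass_converse no_bypass by blast
qed (use finV irr strongV strong_del card3 zV degV in auto)

lemma second_entry:
  assumes "A \<subseteq> V" "A \<noteq> {}" "q \<in> V - A" "V - {q} - A \<noteq> {}"
  obtains x y where "x \<in> V - A" "x \<noteq> q" "y \<in> A" "(x, y) \<in> E"
proof -
  have "V - {q} - (V - {q} - A) \<noteq> {}" using assms by auto
  then obtain x y where "x \<in> V - {q} - A" "y \<in> V - {q} - (V - {q} - A)" "(x, y) \<in> E"
    using strong_on_leaves[OF strong_del, of q "V - {q} - A"] assms by auto
  then show ?thesis using that[of x y] by auto
qed

text \<open>A single in-neighbour would be a cut vertex.\<close>

lemma two_ins:
  assumes "v \<in> V" shows "card (ins E V v) \<ge> 2"
proof (rule ccontr)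
  assume "\<not> ?thesis"
  then have "card (ins E V v) \<le> Suc 0" by simp
  then have sing: "\<And>x y. x \<in> ins E V v \<Longrightarrow> y \<in> ins E V v \<Longrightarrow> x = y"
    using card_le_Suc0_iff_eq[of "ins E V v"] finV by auto
  have "V \<noteq> {v}" using card3 by auto
  then have "V - {v} \<noteq> {}" using assms by auto
  then obtain q where q: "q \<in> V - {v}" "(q, v) \<in> E"
    using strong_on_leaves[OF strongV, of "V - {v}"] assms by auto
  have "\<not> V \<subseteq> {q, v}" using card3 card_mono[of "{q, v}" V] card_insert_le_m1[of 2 "{v}" q] by auto
  then obtain x where "x \<in> V - {v}" "x \<noteq> q" "(x, v) \<in> E"
    using second_entry[of "{v}" q] assms q by auto
  then show False using sing[of x q] q by (auto simp: ins_def)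
qed

text \<open>
  By the theorem on longest cycles it remains to exclude that a longest cycle misses \<open>z\<close> and one more
  vertex \<open>u\<close>. Then \<open>u\<close> has the largest degree to the cycle that noninsertability permits. Let \<open>z\<close> dominate
  \<open>x\<close>, and let \<open>w\<close>, \<open>y\<close>, \<open>x\<close> be consecutive. Either \<open>w\<close> dominates \<open>u\<close>, and replacing \<open>y\<close> by \<open>u\<close>, \<open>z\<close> gives a
  longer cycle, or \<open>u\<close> dominates \<open>y\<close>, and the path \<open>u\<close>, \<open>z\<close>, \<open>x\<close>, \<dots>, \<open>y\<close> is a bypass.
\<close>

lemma cycle_avoiding_z:
  obtains xs where "dcycle E xs" "set xs = V - {z}"
proof -
  have "\<not> V \<subseteq> {z}" using card3 card_mono[of "{z}" V] by auto
  then obtain b where b: "b \<in> V" "b \<noteq> z" by auto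
  obtain ys0 where "dcycle E ys0" "set ys0 \<subseteq> V" using strong_on_cycle[OF irr strongV b(1) zV b(2)] by auto
  then obtain xs where xs: "longest_cycle E V xs" using longest_cycle_exists[OF finV irr strongV] by metis
  interpret longest_cycle E V xs by (rule xs)
  have d: "distinct xs" using cycle dcycle_distinct by blast
  consider "R = {}" | "R = {z}" | u where "u \<noteq> z" "R = {u, z}" "(u, z) \<in> E" "(z, u) \<in> E"
    using longest_cycle_one_exception[OF xs zV degV] by blast
  then show ?thesis
  proof cases
    case 1 then show ?thesis using no_ham[OF cycle] cycle_in by blast
  next
    case 2
    then have "set xs = V - {z}" using cycle_in by auto
    then show ?thesis using that cycle by blast
  next
    case (3 u)
    have uV: "u \<in> V" "u \<notin> C" "z \<notin> C" using 3 by auto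
    have "V - {u} - {z} = C" using 3 cycle_in by auto
    moreover have "C \<noteq> {}" using dcycle_not_empty[OF cycle] by simp
    ultimately obtain x where x: "x \<in> C" "(z, x) \<in> E"
      using strong_on_leaves[OF strong_del[OF uV(1)], of "{z}"] zV 3(1) by auto
    obtain y where y: "y \<in> C" "nxt xs y = x" using nxt_onto[OF d x(1)] by auto
    have "deg E R u + 2 \<le> 2 * card R" using deg_le_irrefl[of R E u] irr 3 finV by auto
    then have "deg E R u \<le> 2" using 3 by auto
    then have dC: "deg E C u \<ge> m"
      using deg_split[OF finV cycle_in, of E u] degV[of u] uV 3 card_V by auto
    have "m \<ge> 1" using dcycle_ge2[OF irr cycle] by simp
    then have dis: "nxt xs ` ins E C u \<inter> outs E C u = {}"
      using no_detour[of "[u]" _ 1] uV by auto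
    have sub: "nxt xs ` ins E C u \<subseteq> C" "outs E C u \<subseteq> C" using nxt_in[OF d] by (auto simp: ins_def outs_def)
    have "inj_on (nxt xs) (ins E C u)" using nxt_bij[OF d] ins_subset[of E C u]
      by (metis bij_betw_imp_inj_on inj_on_subset)
    then have "card (nxt xs ` ins E C u \<union> outs E C u) = deg E C u"
      using dis by (subst card_Un_disjoint) (auto simp: card_image deg_def)
    then have "nxt xs ` ins E C u \<union> outs E C u = C"
      using dC sub distinct_card[OF d] by (intro card_seteq) auto
    then have "y \<in> nxt xs ` ins E C u \<union> outs E C u" using y(1) by simp
    then consider "(u, y) \<in> E" | w where "w \<in> ins E C u" "nxt xs w = y" by (auto simp: outs_def)
    then show ?thesis
    proof cases
      case 1
      obtain ys where ys: "dcycle E ys" "set ys = C" "last ys = y" "hd ys = x"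
        using dcycle_rotate[OF cycle y(1)] y(2) by metis
      have ne: "ys \<noteq> []" using dcycle_not_empty[OF ys(1)] .
      have "dpath E ([u] @ [z])" using 3 by (subst dpath_append) auto
      then have "dpath E ([u, z] @ ys)" using ys ne x uV by (subst dpath_append) (auto simp: dcycle_def)
      moreover have "set ([u, z] @ ys) = V" using ys 3(2) cycle_in by auto
      ultimately have "bypass E V" unfolding bypass_def
        using ne ys 1 by (intro exI[of _ "[u, z] @ ys"]) auto
      then show ?thesis using no_bypass by simp
    next
      case (2 w)
      have "dpath E ([u] @ [z])" using 3 by (subst dpath_append) auto
      moreover have "m \<ge> 2" using dcycle_ge2[OF irr cycle] .
      ultimately have "(nxt xs ^^ 2) w \<notin> outs E C (last [u, z])"
        using 2 3 by (intro no_detour) auto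
      moreover have "(nxt xs ^^ 2) w = x" using 2 y by (simp add: numeral_2_eq_2)
      ultimately show ?thesis using x by (auto simp: outs_def)
    qed
  qed
qed

text \<open>
  Otherwise the path from \<open>nxt xs (nxt xs a)\<close> round to \<open>a\<close> and on to \<open>z\<close> has an arc from its initial to its
  terminal vertex and misses only \<open>v = nxt xs a\<close>. The degree of \<open>v\<close> suffices to insert it, unless \<open>z\<close> dominates \<open>v\<close>;
  but that arc would close a Hamiltonian cycle.
\<close>

lemma ins_z_distance_two:
  assumes xs: "dcycle E xs" "set xs = V - {z}" and n: "length xs \<ge> 3"
    and a: "a \<in> set xs" "(a, z) \<in> E"
  shows "(nxt xs (nxt xs a), z) \<notin> E"
proof
  assume e: "(nxt xs (nxt xs a), z) \<in> E"
  obtain ys where ys: "dcycle E ys" "set ys = set xs" "length ys = length xs" "last ys = a"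
    "hd ys = nxt xs a" "\<And>k. k < length xs \<Longrightarrow> ys ! k = (nxt xs ^^ Suc k) a"
    using dcycle_rotate[OF xs(1) a(1)] by metis
  define v where "v = nxt xs a"
  define t where "t = tl ys"
  have yt: "ys = v # t" "t \<noteq> []" using ys n by (cases ys; auto simp: v_def t_def)+
  then have t: "dpath E t" "v \<notin> set t" "(v, hd t) \<in> E" "last t = a"
    using ys(1,4) by (auto simp: dcycle_def dpath_def successively_Cons)
  have "hd t = ys ! 1" using yt by (simp add: hd_conv_nth)
  then have ht: "hd t = nxt xs (nxt xs a)" using ys(6)[of 1] n by simp
  define w where "w = t @ [z]"
  have zt: "z \<notin> set t" "z \<noteq> v" using ys(2) xs(2) yt by auto
  have w: "dpath E w" "hd w = hd t" "last w = z" "set w = V - {v}" "w \<noteq> []" "length w + 1 = card V"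
  proof -
    show "dpath E w" using t zt yt a by (auto simp: w_def dpath_append)
    show "hd w = hd t" "last w = z" "w \<noteq> []" using yt by (auto simp: w_def)
    have "V = insert z (insert v (set t))" using xs(2) ys(2) yt zV by auto
    then show "set w = V - {v}" using t zt by (auto simp: w_def)
    show "length w + 1 = card V"
      using ys(3) yt xs dcycle_card[OF xs(1)] zV finV by (simp add: w_def)
  qed
  have vV: "v \<in> V - {z}" using nxt_in[OF dcycle_distinct[OF xs(1)] a(1)] xs(2) by (simp add: v_def)
  have "(z, v) \<notin> E"
  proof
    assume "(z, v) \<in> E"
    then have "dcycle E (v # w)" using w t by (auto simp: dcycle_def dpath_def successively_Cons)
    then show False using no_ham[of "v # w"] w(4) vV by auto
  qed
  show False
  proof (cases "\<exists>c d. (c, d) \<in> adj w \<and> (c, v) \<in> E \<and> (v, d) \<in> E")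
    case True
    then obtain w' where "dpath E w'" "set w' = set w \<union> {v}" "hd w' = hd w" "last w' = last w"
      using insert_all[OF w(1), of "[v]"] w(4) by auto
    then have "bypass E V" using w e ht vV unfolding bypass_def by (intro exI[of _ w']) auto
    then show False using no_bypass by simp
  next
    case False
    then have "deg E (set w) v + 1 \<le> length w + of_bool ((last w, v) \<in> E) + of_bool ((v, hd w) \<in> E)"
      using w(1,5) by (intro deg_no_slot) (auto simp: dpath_def)
    then have "deg E (set w) v \<le> length w" using \<open>(z, v) \<notin> E\<close> w(3) by (simp add: of_bool_def split: if_splits)
    moreover have "deg E (set w) v = deg E V v" using deg_self_remove[OF finV irr] vV w(4) by auto
    ultimately show False using degV[OF vV] w(6) by simp
  qed
qed

lemma z_on_cycle: "\<exists>zs. dcycle E zs \<and> set zs \<subseteq> V \<and> z \<in> set zs"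
proof -
  have "V - {z} \<noteq> {}" using card3 card_mono[of "{z}" V] by auto
  then obtain w where w: "w \<in> V - {z}" "(z, w) \<in> E" using strong_on_leaves[OF strongV, of "{z}"] zV by auto
  obtain P where P: "dpath E P" "set P \<subseteq> V" "hd P = w" "last P = z"
    using strong_on_path[OF strongV, of w z] w zV by auto
  have "P \<noteq> []" using P by (simp add: dpath_def)
  then show ?thesis using P w by (intro exI[of _ P]) (auto simp: dcycle_def)
qed

text \<open>
  The in-neighbours of \<open>z\<close> on a cycle through all other vertices are at least three apart,
  and so are its out-neighbours. If moreover no out-neighbour follows an in-neighbour within
  \<open>K\<close> steps, the shifts of the out-neighbours by \<open>0, 1, 2\<close> and of the in-neighbours by \<open>3, \<dots>, K\<close> are pairwise
  disjoint. For \<open>K = 2\<close> the spacing of the out-neighbours alone matters.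
\<close>

lemma shifted_neighbours_bound:
  assumes xs: "dcycle E xs" "set xs = V - {z}" and n: "length xs \<ge> 3"
    and K: "2 \<le> K" "K \<le> 5"
    and far: "\<And>a l. a \<in> ins E V z \<Longrightarrow> 1 \<le> l \<Longrightarrow> l \<le> K \<Longrightarrow> K > 2 \<Longrightarrow> (nxt xs ^^ l) a \<notin> outs E V z"
  shows "3 * card (outs E V z) + (K - 2) * card (ins E V z) \<le> length xs"
proof -
  let ?I = "ins E V z" and ?O = "outs E V z" and ?s = "nxt xs"
  have d: "distinct xs" using xs dcycle_distinct by blast
  have IO: "?I \<subseteq> set xs" "?O \<subseteq> set xs" using xs(2) irr by (auto simp: ins_def outs_def irrefl_def)
  have zn: "z \<notin> set xs" "insert z (set xs) = V" using xs(2) zV by auto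
  have I1: "?s a \<notin> ?I" if "a \<in> ?I" for a
    using bypass_consecutive_ins[OF xs(1) zn(1), of a] that IO no_bypass zn(2) by (auto simp: ins_def)
  have O1: "?s a \<notin> ?O" if "a \<in> ?O" for a
    using bypass_consecutive_outs[OF xs(1) zn(1), of a] that IO no_bypass zn(2) by (auto simp: outs_def)
  have I2: "?s (?s a) \<notin> ?I" if "a \<in> ?I" for a
    using ins_z_distance_two[OF xs n, of a] that IO by (auto simp: ins_def)
  have O2: "?s (?s a) \<notin> ?O" if a: "a \<in> ?O" for a
  proof
    interpret D: no_ham_no_bypass "E\<inverse>" V z by (rule dual_nonham)
    assume o: "?s (?s a) \<in> ?O"
    have aC: "a \<in> set xs" "?s a \<in> set xs" "?s (?s a) \<in> set xs" using a IO nxt_in[OF d] by blast+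
    have "(nxt (rev xs) (nxt (rev xs) (?s (?s a))), z) \<notin> E\<inverse>"
      using o aC xs n by (intro D.ins_z_distance_two) (auto simp: dcycle_rev outs_def)
    then show False using nxt_rev[OF d] aC a by (simp add: outs_def)
  qed
  have inj: "inj_on ?s (set xs)" using nxt_bij[OF d] by (simp add: bij_betw_def)
  have cancel: "x = (?s ^^ (b - a)) y" if "(?s ^^ a) x = (?s ^^ b) y" "a \<le> b" "x \<in> set xs" "y \<in> set xs" for a b x y
    using that
  proof (induction a arbitrary: b)
    case (Suc a)
    then obtain b' where b: "b = Suc b'" by (cases b) auto
    then have "?s ((?s ^^ a) x) = ?s ((?s ^^ b') y)" using Suc by simp
    then have "(?s ^^ a) x = (?s ^^ b') y" using inj nxt_pow_in[OF d] Suc.prems by (metis inj_on_eq_iff)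
    then show ?case using Suc.IH[of b'] Suc.prems b by simp
  qed simp
  \<comment> \<open>Shifts by \<open>a\<close> and \<open>b\<close> meet only if elements of the two sets are \<open>b - a\<close> steps apart.\<close>
  define F where "F j = (?s ^^ j) ` (if j \<le> 2 then ?O else ?I)" for j
  have dist12: "\<not> (b - a = 1 \<or> b - a = 2)" if "x = (?s ^^ (b - a)) y" "x \<in> S" "y \<in> S" "S = ?I \<or> S = ?O" for a b x y S
    using that I1 I2 O1 O2 by (auto simp: numeral_2_eq_2)
  have disj: "F a \<inter> F b = {}" if ab: "a < b" "b \<le> K" for a b
  proof (rule ccontr)
    assume "F a \<inter> F b \<noteq> {}"
    then obtain x y where xy: "x \<in> (if a \<le> 2 then ?O else ?I)" "y \<in> (if b \<le> 2 then ?O else ?I)"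
      "(?s ^^ a) x = (?s ^^ b) y" by (auto simp: F_def)
    then have xC: "x \<in> set xs" "y \<in> set xs" using IO by (auto split: if_splits)
    have x: "x = (?s ^^ (b - a)) y" using cancel[OF xy(3) _ xC] ab by simp
    show False
    proof (cases "a \<le> 2 \<and> \<not> b \<le> 2")
      case True
      moreover have "1 \<le> b - a" "b - a \<le> K" using ab by auto
      ultimately show False using far[of y "b - a"] xy(1,2) ab x by auto
    next
      case False
      then have "b - a = 1 \<or> b - a = 2" using ab K by auto
      moreover have "\<exists>S. x \<in> S \<and> y \<in> S \<and> (S = ?I \<or> S = ?O)" using xy False ab by (auto split: if_splits)
      ultimately show False using dist12[OF x] by blast
    qed
  qed
  have injk: "inj_on (?s ^^ k) (set xs)" for k
    using cancel[of k _ k] by (auto intro!: inj_onI)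
  have cF: "card (F j) = (if j \<le> 2 then card ?O else card ?I)" for j
    using IO by (auto simp: F_def intro!: card_image inj_on_subset[OF injk])
  have sub: "F j \<subseteq> set xs" for j using IO nxt_pow_in[OF d] by (auto simp: F_def)
  have "(\<Sum>j\<in>{0..K}. card (F j)) = card (\<Union>j\<in>{0..K}. F j)"
  proof (intro card_UN_disjoint[symmetric] ballI impI)
    show "finite (F j)" for j using finite_subset[OF sub] by simp
    show "F a \<inter> F b = {}" if "a \<in> {0..K}" "b \<in> {0..K}" "a \<noteq> b" for a b
      using that disj[of a b] disj[of b a] by (cases "a < b") auto
  qed simp
  also have "\<dots> \<le> card (set xs)" using sub by (intro card_mono) auto
  finally have 1: "(\<Sum>j\<in>{0..K}. card (F j)) \<le> length xs" using distinct_card[OF d] by simp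
  have "{0..K} = {0..2} \<union> {3..K}" using K by auto
  then have "(\<Sum>j\<in>{0..K}. card (F j)) = (\<Sum>j\<in>{0..2}. card (F j)) + (\<Sum>j\<in>{3..K}. card (F j))"
    by (simp only:) (rule sum.union_disjoint; auto)
  also have "\<dots> = (\<Sum>j\<in>{0..2::nat}. card ?O) + (\<Sum>j\<in>{3..K}. card ?I)"
    by (intro arg_cong2[where f = "(+)"] sum.cong) (auto simp: cF)
  also have "\<dots> = 3 * card ?O + (K - 2) * card ?I" using K by simp
  finally show ?thesis using 1 by simp
qed

end

section \<open>Long cycles through the exceptional vertex\<close>

text \<open>
  A longest cycle among those through \<open>z\<close> need not be a longest cycle, so the vertex \<open>z\<close> must stay when a
  stretch of it is replaced. Attachments are therefore recorded by their positions on the cycle cut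
  open at \<open>z\<close>: as the source of an arc \<open>z\<close> has position \<open>0\<close>, as a target it has position \<open>m\<close>.
  The vertices strictly between positions \<open>i < j\<close> then never include \<open>z\<close>.
\<close>

locale long_z_cycle = no_ham_no_bypass +
  fixes cs :: "'a list"
  assumes cyc: "dcycle E cs" and hd_cs: "hd cs = z" and cs_in: "set cs \<subseteq> V"
    and longest_z: "\<And>zs. dcycle E zs \<Longrightarrow> set zs \<subseteq> V \<Longrightarrow> z \<in> set zs \<Longrightarrow> length zs \<le> length cs"
begin

abbreviation "C \<equiv> set cs"
abbreviation "m \<equiv> length cs"
abbreviation "R \<equiv> V - set cs"
abbreviation "r \<equiv> card (V - set cs)"

definition "inpos v = {i. i < m \<and> (cs ! i, v) \<in> E}"
definition "outpos v = {j. 1 \<le> j \<and> j \<le> m \<and> (v, cs ! (j mod m)) \<in> E}"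

lemma dist: "distinct cs"
  using cyc dcycle_distinct by blast

lemma m_pos: "m \<ge> 1"
  using dcycle_not_empty[OF cyc] by (cases cs) auto

lemma cs0: "cs ! 0 = z"
  using hd_cs dcycle_not_empty[OF cyc] by (simp add: hd_conv_nth)

lemma zC: "z \<in> C"
  using hd_cs dcycle_not_empty[OF cyc] hd_in_set by metis

lemma fin_IO [simp]: "finite (inpos v)" "finite (outpos v)"
  by (auto simp: inpos_def outpos_def)

lemma I_sub: "inpos v \<subseteq> {0..<m}" and O_sub: "outpos v \<subseteq> {1..m}"
  by (auto simp: inpos_def outpos_def)

lemma card_I: "card (inpos v) = card (ins E C v)"
proof (rule bij_betw_same_card)
  show "bij_betw ((!) cs) (inpos v) (ins E C v)" unfolding bij_betw_def
    using dist by (auto simp: inpos_def ins_def inj_on_def nth_eq_iff_index_eq in_set_conv_nth)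
qed

lemma mod_inj: "j \<in> {1..m} \<Longrightarrow> k \<in> {1..m} \<Longrightarrow> j mod m = k mod m \<Longrightarrow> j = k"
  by (cases "j = m"; cases "k = m") auto

lemma card_O: "card (outpos v) = card (outs E C v)"
proof (rule bij_betw_same_card)
  have "inj_on (\<lambda>j. cs ! (j mod m)) (outpos v)"
  proof (rule inj_onI)
    fix j k assume jk: "j \<in> outpos v" "k \<in> outpos v" "cs ! (j mod m) = cs ! (k mod m)"
    moreover have "j mod m < m" "k mod m < m" using m_pos by (intro mod_less_divisor; linarith)+
    ultimately have "j mod m = k mod m" using dist nth_eq_iff_index_eq by blast
    then show "j = k" using mod_inj jk O_sub by blast
  qed
  moreover have "(\<lambda>j. cs ! (j mod m)) ` outpos v = outs E C v"
  proof (intro equalityI subsetI)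
    fix x assume "x \<in> outs E C v"
    then obtain k where k: "k < m" "cs ! k = x" "(v, x) \<in> E" by (auto simp: outs_def in_set_conv_nth)
    define j where "j = (if k = 0 then m else k)"
    have "j \<in> outpos v" "cs ! (j mod m) = x" using k m_pos by (auto simp: outpos_def j_def)
    then show "x \<in> (\<lambda>j. cs ! (j mod m)) ` outpos v" by blast
  next
    fix x assume "x \<in> (\<lambda>j. cs ! (j mod m)) ` outpos v"
    then obtain j where "x = cs ! (j mod m)" "(v, x) \<in> E" by (auto simp: outpos_def)
    moreover have "j mod m < m" using m_pos by (intro mod_less_divisor) linarith
    ultimately show "x \<in> outs E C v" by (auto simp: outs_def)
  qed
  ultimately show "bij_betw (\<lambda>j. cs ! (j mod m)) (outpos v) (outs E C v)" by (simp add: bij_betw_def)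
qed

lemma deg_C: "deg E C v = card (inpos v) + card (outpos v)"
  by (simp add: deg_def card_I card_O)

lemma card_V: "card V = m + r"
  using dcycle_card[OF cyc] cs_in finV
  by (metis List.finite_set card_Diff_subset card_mono le_add_diff_inverse)

lemma degR: "v \<in> R \<Longrightarrow> deg E V v \<ge> card V"
  using degV zC by blast

lemma deg_V_split: "deg E V v = card (inpos v) + card (outpos v) + deg E R v"
  using deg_split[OF finV cs_in, of E v] deg_C by simp

lemma splice:
  assumes "i \<in> inpos (hd P)" "j \<in> outpos (last P)" "i < j" "dpath E P" "set P \<subseteq> R"
  shows "dcycle E (take (Suc i) cs @ P @ drop j cs)"
proof -
  have i: "i < m" "(cs ! i, hd P) \<in> E" and j: "1 \<le> j" "j \<le> m" "(last P, cs ! (j mod m)) \<in> E"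
    using assms by (auto simp: inpos_def outpos_def)
  have P: "P \<noteq> []" using assms by (auto simp: dpath_def)
  have cp: "dpath E cs" "(last cs, hd cs) \<in> E" using cyc by (auto simp: dcycle_def)
  define A where "A = take (Suc i) cs"
  define B where "B = drop j cs"
  have A: "A \<noteq> []" "last A = cs ! i" "hd A = hd cs" "dpath E A"
  proof -
    show "A \<noteq> []" using i by (auto simp: A_def)
    show "last A = cs ! i" using i by (simp add: A_def take_Suc_conv_app_nth)
    show "hd A = hd cs" by (simp add: A_def)
    have "dpath E (A @ drop (Suc i) cs)" using cp by (simp add: A_def)
    then show "dpath E A" using \<open>A \<noteq> []\<close> by (cases "drop (Suc i) cs = []") (auto simp: dpath_append)
  qed
  have AB: "set A \<inter> set B = {}" unfolding A_def B_def
    using dist assms(3) by (intro set_take_disj_set_drop_if_distinct) auto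
  have sets: "set A \<subseteq> C" "set B \<subseteq> C" unfolding A_def B_def by (auto dest: in_set_takeD in_set_dropD)
  show ?thesis
  proof (cases "B = []")
    case True
    then have "j = m" using j by (simp add: B_def)
    then have "(last P, hd cs) \<in> E" using j m_pos cs0 hd_cs by simp
    then have "dcycle E (A @ P)" using A P i assms(4,5) sets by (auto simp: dcycle_def dpath_append)
    then show ?thesis using True by (simp add: A_def B_def)
  next
    case False
    then have jm: "j < m" by (simp add: B_def)
    have B: "hd B = cs ! j" "last B = last cs" "dpath E B"
    proof -
      show "hd B = cs ! j" "last B = last cs" using jm by (auto simp: B_def hd_drop_conv_nth)
      have "dpath E (take j cs @ B)" using cp by (simp add: B_def)
      then show "dpath E B" using False by (cases "take j cs = []") (auto simp: dpath_append)
    qed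
    have "dcycle E (A @ (P @ B))"
      using A B P i j jm AB False assms(4,5) sets cp by (auto simp: dcycle_def dpath_append)
    then show ?thesis by (simp add: A_def B_def)
  qed
qed

lemma splice_set: "set (take (Suc i) cs @ P @ drop j cs) \<subseteq> C \<union> set P"
  by (auto dest: in_set_takeD in_set_dropD)

lemma splice_z: "z \<in> set (take (Suc i) cs @ P @ drop j cs)"
  using hd_cs dcycle_not_empty[OF cyc] by (cases cs) auto

text \<open>Replacing the stretch of the cycle between two attachments cannot lengthen it.\<close>

lemma gap:
  assumes "i \<in> inpos (hd P)" "j \<in> outpos (last P)" "i < j" "dpath E P" "set P \<subseteq> R"
  shows "i + length P < j"
proof -
  have "length (take (Suc i) cs @ P @ drop j cs) \<le> m"
    using splice[OF assms] splice_z splice_set[of i P j] assms(5) cs_in by (intro longest_z) auto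
  moreover have "i < m" "j \<le> m" using assms by (auto simp: inpos_def outpos_def)
  ultimately show ?thesis by (simp add: min_def split: if_splits)
qed

lemma I_O_disjoint:
  assumes "u \<in> R" "v \<in> R" "dpath E P" "set P \<subseteq> R" "hd P = u" "last P = v" "i \<in> inpos u"
  shows "Suc i \<notin> outpos v"
  using gap[of i P "Suc i"] assms by (auto simp: dpath_def Suc_le_eq)

lemma deg_C_le:
  assumes "v \<in> R" shows "card (inpos v) + card (outpos v) \<le> m"
proof -
  have "Suc ` inpos v \<inter> outpos v = {}" using I_O_disjoint[of v v "[v]"] assms by auto
  then have "card (Suc ` inpos v \<union> outpos v) = card (inpos v) + card (outpos v)"
    by (subst card_Un_disjoint) (auto simp: card_image)
  moreover have "Suc ` inpos v \<union> outpos v \<subseteq> {1..m}" using I_sub O_sub by fastforce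
  then have "card (Suc ` inpos v \<union> outpos v) \<le> m" using card_mono[of "{1..m}"] by fastforce
  ultimately show ?thesis by simp
qed

lemma deg_R_ge:
  assumes "v \<in> R" shows "deg E R v \<ge> r"
  using deg_C_le[OF assms] deg_V_split[of v] degR[OF assms] card_V by linarith

lemma R_nonempty: "R \<noteq> {}"
  using no_ham[OF cyc] cs_in by blast

lemma r_ge2: "r \<ge> 2"
proof -
  obtain v where v: "v \<in> R" using R_nonempty by auto
  have "deg E R v + 2 \<le> 2 * r" using deg_le_irrefl[of R E v] irr v finV by auto
  then show ?thesis using deg_R_ge[OF v] by linarith
qed

text \<open>Here the whole cycle is traversed, then all of \<open>R\<close>.\<close>

lemma bypass_ins:
  assumes "dpath E P" "set P = R" "i \<in> inpos (hd P)" shows "Suc i \<notin> inpos (last P)"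
proof
  assume s: "Suc i \<in> inpos (last P)"
  then have i: "Suc i < m" "(cs ! Suc i, last P) \<in> E" "(cs ! i, hd P) \<in> E" using assms by (auto simp: inpos_def)
  define D where "D = drop (Suc i) cs @ take (Suc i) cs"
  have "dcycle E D" using cyc dcycle_append_swap[of E "take (Suc i) cs" "drop (Suc i) cs"] by (simp add: D_def)
  moreover have D: "D \<noteq> []" "hd D = cs ! Suc i" "last D = cs ! i"
    using i by (auto simp: D_def hd_drop_conv_nth take_Suc_conv_app_nth)
  moreover have DC: "set D = C" unfolding D_def by (metis append_take_drop_id set_append sup_commute)
  moreover have P: "P \<noteq> []" using assms by (auto simp: dpath_def)
  ultimately have "dpath E (D @ P)" using assms i by (auto simp: dpath_append dcycle_def)
  moreover have "set (D @ P) = V" using DC assms(2) cs_in by auto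
  ultimately have "bypass E V" unfolding bypass_def using D P i by (intro exI[of _ "D @ P"]) auto
  then show False using no_bypass by simp
qed

lemma bypass_outs:
  assumes "dpath E P" "set P = R" "j \<in> outpos (hd P)" shows "Suc j \<notin> outpos (last P)"
proof
  assume s: "Suc j \<in> outpos (last P)"
  then have j: "1 \<le> j" "Suc j \<le> m" "(last P, cs ! (Suc j mod m)) \<in> E" "(hd P, cs ! j) \<in> E"
    using assms by (auto simp: outpos_def)
  define D where "D = drop (Suc j) cs @ take (Suc j) cs"
  have "dcycle E D" using cyc dcycle_append_swap[of E "take (Suc j) cs" "drop (Suc j) cs"] by (simp add: D_def)
  moreover have D: "D \<noteq> []" "last D = cs ! j" using j by (auto simp: D_def take_Suc_conv_app_nth)
  moreover have hD: "hd D = cs ! (Suc j mod m)"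
    using j hd_cs cs0 by (cases "Suc j = m") (auto simp: D_def hd_drop_conv_nth)
  moreover have DC: "set D = C" unfolding D_def by (metis append_take_drop_id set_append sup_commute)
  moreover have P: "P \<noteq> []" using assms by (auto simp: dpath_def)
  ultimately have "dpath E (P @ D)" using assms j by (auto simp: dpath_append dcycle_def)
  moreover have "set (P @ D) = V" using DC assms(2) cs_in by auto
  ultimately have "bypass E V" unfolding bypass_def using D P j by (intro exI[of _ "P @ D"]) auto
  then show False using no_bypass by simp
qed

lemma two_sets:
  assumes "finite S" "card S = 2" "a \<in> S"
  obtains b where "S = {a, b}" "b \<noteq> a"
proof -
  have "card (S - {a}) = 1" using assms by simp
  then obtain b where "S - {a} = {b}" by (auto simp: card_1_singleton_iff)
  then show ?thesis using that[of b] assms(3) by auto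
qed

text \<open>
  If \<open>R\<close> were not strong, it would consist of two 2-cycles \<open>A\<close> and \<open>B\<close> with all arcs from \<open>A\<close> to \<open>B\<close>, and
  every vertex of \<open>R\<close> would have the largest possible degree to the cycle. An in-neighbour of \<open>A\<close> at
  a position \<open>i\<close> with \<open>i + 2 \<le> m\<close> then gives a bypass or a longer cycle through \<open>z\<close>. So all arcs
  into \<open>A\<close> come from the last vertex of the cycle, which is a cut vertex.
\<close>

lemma rest_strong:
  assumes r4: "r \<le> 4"
  shows "strong_on E R"
proof -
  obtain A where A: "A \<subseteq> R" "A \<noteq> {}" "strong_on E A" "\<And>v w. v \<in> A \<Longrightarrow> w \<in> R - A \<Longrightarrow> (w, v) \<notin> E"
    using initial_component[of R R E] R_nonempty finV by auto
  show ?thesis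
  proof (cases "A = R")
    case True then show ?thesis using A by simp
  next
    case False
    define B where "B = R - A"
    have B: "B \<noteq> {}" "A \<inter> B = {}" "A \<union> B = R" using False A by (auto simp: B_def)
    have fin: "finite A" "finite B" using A(1) finV B_def by (auto intro: finite_subset)
    have cr: "r = card A + card B" using B fin card_Un_disjoint by metis
    have dAB: "deg E R v = deg E A v + deg E B v" for v using deg_Un[OF fin B(2)] B(3) by metis
    have insB: "ins E B u = {}" if "u \<in> A" for u using A(4)[OF that] by (auto simp: ins_def B_def)
    have outsA: "outs E A w = {}" if "w \<in> B" for w using A(4) that by (auto simp: outs_def B_def)
    have dB: "deg E B u \<le> card B" if "u \<in> A" for u using insB[OF that] card_outs_le[OF fin(2), of E u] by (simp add: deg_def)
    have dA: "deg E A w \<le> card A" if "w \<in> B" for w using outsA[OF that] card_ins_le[OF fin(1), of E w] by (simp add: deg_def)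
    have AR: "u \<in> R" if "u \<in> A" for u using that B by auto
    have BR: "w \<in> R" if "w \<in> B" for w using that B by auto
    obtain a b where ab: "a \<in> A" "b \<in> B" using A(2) B(1) by auto
    have "card A \<ge> 2"
      using deg_le_irrefl[OF fin(1) irr ab(1)] dB[OF ab(1)] deg_R_ge[OF AR[OF ab(1)]] dAB[of a] cr by linarith
    moreover have "card B \<ge> 2"
      using deg_le_irrefl[OF fin(2) irr ab(2)] dA[OF ab(2)] deg_R_ge[OF BR[OF ab(2)]] dAB[of b] cr by linarith
    ultimately have c: "card A = 2" "card B = 2" "r = 4" using cr r4 by linarith+
    have AA: "deg E A u \<le> 2" if "u \<in> A" for u using deg_le_irrefl[OF fin(1) irr that] c by simp
    have BB: "deg E B w \<le> 2" if "w \<in> B" for w using deg_le_irrefl[OF fin(2) irr that] c by simp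
    have dR4: "deg E R u = 4" if "u \<in> R" for u
    proof -
      have "deg E R u \<le> 4"
      proof (cases "u \<in> A")
        case True then show ?thesis using AA[OF True] dB[OF True] dAB[of u] c by simp
      next
        case False
        then have "u \<in> B" using that B by auto
        then show ?thesis using BB dA dAB[of u] c by fastforce
      qed
      then show ?thesis using deg_R_ge[OF that] c by simp
    qed
    have full: "Suc ` inpos u \<union> outpos u = {1..m}" if u: "u \<in> R" for u
    proof (rule card_seteq)
      have "Suc ` inpos u \<inter> outpos u = {}" using I_O_disjoint[of u u "[u]"] u by auto
      then have "card (Suc ` inpos u \<union> outpos u) = card (inpos u) + card (outpos u)"
        by (subst card_Un_disjoint) (auto simp: card_image)
      then show "card {1..m} \<le> card (Suc ` inpos u \<union> outpos u)"
        using deg_V_split[of u] degR[OF u] card_V dR4[OF u] c by simp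
      show "Suc ` inpos u \<union> outpos u \<subseteq> {1..m}" using I_sub O_sub by fastforce
    qed simp
    have arcAB: "(u, w) \<in> E" if "u \<in> A" "w \<in> B" for u w
    proof -
      have "card (outs E B u) \<ge> 2"
        using dAB[of u] dR4[OF AR[OF that(1)]] AA[OF that(1)] insB[OF that(1)] by (simp add: deg_def)
      then have "outs E B u = B" using outs_subset[of E B u] fin c by (intro card_seteq) auto
      then show ?thesis using that by (auto simp: outs_def)
    qed
    have arcA: "(u, u') \<in> E" if uu: "u \<in> A" "u' \<in> A" "u \<noteq> u'" for u u'
    proof -
      obtain v where "A = {u, v}" "v \<noteq> u" using two_sets[OF fin(1) c(1) uu(1)] .
      then have "A - {u} = {u'}" using uu by auto
      then show ?thesis using strong_on_leaves[OF A(3), of "{u}"] uu(1) by auto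
    qed
    have arcB: "(w, w') \<in> E" if w: "w \<in> B" "w' \<in> B" "w \<noteq> w'" for w w'
    proof -
      have "deg E B w \<ge> 2" using dAB[of w] dR4[OF BR[OF w(1)]] dA[OF w(1)] c by simp
      moreover obtain v where "B = {w, v}" "v \<noteq> w" using two_sets[OF fin(2) c(2) w(1)] .
      then have "B - {w} = {w'}" using w by auto
      ultimately have "deg E {w'} w \<ge> 2" using deg_self_remove[OF fin(2) irr w(1)] by simp
      then show ?thesis by (simp add: deg_single of_bool_def split: if_splits)
    qed
    obtain b' where b': "B = {b, b'}" "b' \<noteq> b" using two_sets[OF fin(2) c(2) ab(2)] .
    have IAB: "inpos u \<subseteq> inpos b" if u: "u \<in> A" for u
    proof
      fix i assume i: "i \<in> inpos u"
      have ub: "u \<noteq> b" using u ab B by auto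
      then have "dpath E [u, b]" using arcAB[OF u ab(2)] by (simp add: dpath_def)
      then have "Suc i \<notin> outpos b" using I_O_disjoint[of u b "[u, b]"] AR[OF u] BR[OF ab(2)] i by auto
      moreover have "Suc i \<in> {1..m}" using i by (auto simp: inpos_def)
      ultimately show "i \<in> inpos b" using full[OF BR[OF ab(2)]] by auto
    qed
    have last_only: "i + 1 = m" if u: "u \<in> A" "i \<in> inpos u" for u i
    proof (rule ccontr)
      assume "i + 1 \<noteq> m"
      then have im: "i + 2 \<le> m" using u I_sub by fastforce
      obtain u' where u': "A = {u, u'}" "u' \<noteq> u" using two_sets[OF fin(1) c(1) u(1)] .
      have "Suc i \<notin> inpos u'"
      proof
        assume "Suc i \<in> inpos u'"
        then have "Suc i \<in> inpos b" using IAB[of u'] u' by auto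
        moreover have "dpath E [u, u', b', b]"
        proof -
          have "u' \<in> A" "b' \<in> B" using u' b' by auto
          then have "(u, u') \<in> E" "(u', b') \<in> E" "(b', b) \<in> E"
            using arcA[OF u(1)] arcAB arcB[OF _ ab(2)] u'(2) b'(2) by auto
          moreover have "u \<notin> {b, b'}" "u' \<notin> {b, b'}"
            using \<open>u' \<in> A\<close> u(1) B(2) unfolding b'(1)[symmetric] by blast+
          ultimately show ?thesis using u'(2) b'(2) by (simp add: dpath_def)
        qed
        moreover have "set [u, u', b', b] = R"
          unfolding B(3)[symmetric] u'(1) b'(1) by auto
        ultimately show False using bypass_ins[of "[u, u', b', b]" i] u(2) by simp
      qed
      moreover have u'A: "u' \<in> A" using u' by auto
      moreover have "i + 2 \<in> {1..m}" using im by simp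
      ultimately have "i + 2 \<in> outpos u'" using full[OF AR[OF u'A]] by auto
      moreover have "dpath E [u, u']" using arcA[OF u(1) u'A] u'(2) by (simp add: dpath_def)
      ultimately show False
        using gap[of i "[u, u']" "i + 2"] u(2) AR[OF u(1)] AR[OF u'A] by simp
    qed
    have "cs ! (m - 1) \<in> V - A" using A(1) cs_in m_pos nth_mem[of "m - 1" cs] by auto
    moreover have "V - {cs ! (m - 1)} - A \<noteq> {}"
    proof -
      have "b \<in> V - A" "b \<notin> C" using ab B by auto
      then show ?thesis using nth_mem[of "m - 1" cs] m_pos by auto
    qed
    ultimately obtain x y where xy: "x \<in> V - A" "x \<noteq> cs ! (m - 1)" "y \<in> A" "(x, y) \<in> E"
      using second_entry[of A "cs ! (m - 1)"] A by blast
    then have "x \<in> C" using A(4)[of y x] by auto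
    then obtain i where "i < m" "cs ! i = x" by (auto simp: in_set_conv_nth)
    moreover from this have "i + 1 \<noteq> m" using xy(2) by (metis add_diff_cancel_right')
    ultimately have "i \<in> inpos y" "i + 1 \<noteq> m" using xy by (auto simp: inpos_def)
    then show ?thesis using last_only[OF xy(3)] by blast
  qed
qed

text \<open>
  Let \<open>UI\<close> and \<open>UO\<close> collect the attachments of all of \<open>R\<close>. Each single vertex misses few of them. In
  \<open>UI\<close> no position precedes one of \<open>UO\<close>. Otherwise take such positions \<open>a < b\<close> as close as possible. If
  \<open>b = a + 2\<close>, some vertex \<open>u\<close> of \<open>R\<close> can be exchanged with the vertex \<open>q\<close> between them; then \<open>q\<close> has no
  neighbours off a longest cycle through \<open>z\<close>, contrary to its degree. If the gap is larger, each vertex of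
  \<open>R\<close> misses at most one attachment because \<open>r \<le> 4\<close>, and going round the Hamiltonian cycle of \<open>R\<close> shows that
  \<open>b\<close> is attached to every vertex and \<open>a\<close> to none.

  Hence the out-attachments lie in \<open>1, \<dots>, k\<close> and the in-attachments in \<open>k, \<dots>, m - 1\<close> for some \<open>k\<close>. As no
  bypass exists, two consecutive vertices of \<open>R\<close> have together at most \<open>m + 2\<close> attachments, while their
  degrees require at least \<open>2 * (m + 2 - r)\<close>.
\<close>

lemma impossible:
  assumes r4: "r \<le> 4" and m_large: "m + 1 \<ge> 2 * r"
  shows False
proof -
  have finR: "finite R" using finV by simp
  have st: "strong_on E R" by (rule rest_strong[OF r4])
  obtain ys where ys: "dcycle E ys" "set ys = R"
    using ghouila_houri[OF finR irr st r_ge2 deg_R_ge] by metis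
  have yd: "distinct ys" using ys dcycle_distinct by blast
  let ?t = "nxt ys"
  have tR: "?t y \<in> R" if "y \<in> R" for y using nxt_in[OF yd] that ys by metis
  have path_R: "\<exists>P. dpath E P \<and> set P = R \<and> length P = r \<and> hd P = ?t y \<and> last P = y" if "y \<in> R" for y
    using dcycle_rotate[OF ys(1), of y] that ys dcycle_card[OF ys(1)] unfolding dcycle_def by metis
  define UI where "UI = (\<Union>y\<in>R. inpos y)"
  define UO where "UO = (\<Union>y\<in>R. outpos y)"
  have sub: "UI \<subseteq> {0..<m}" "UO \<subseteq> {1..m}" using I_sub O_sub by (auto simp: UI_def UO_def)
  have fU: "finite UI" "finite UO" using sub by (auto intro: finite_subset)
  have low: "card (inpos y) + card (outpos y) + r \<ge> m + 2" if y: "y \<in> R" for y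
  proof -
    have "deg E R y + 2 \<le> 2 * r" using deg_le_irrefl[OF finR irr y] .
    then show ?thesis using deg_V_split[of y] degR[OF y] card_V by linarith
  qed
  have not_forward: "\<not> i < j" if ij: "i \<in> UI" "j \<in> UO" for i j
  proof
    assume "i < j"
    let ?Q = "\<lambda>(i, j). i \<in> UI \<and> j \<in> UO \<and> i < j"
    have "?Q (i, j)" using ij \<open>i < j\<close> by simp
    then obtain ij where q: "?Q ij" "\<And>x. ?Q x \<Longrightarrow> snd ij - fst ij \<le> snd x - fst x"
      using ex_has_least_nat[of ?Q "(i, j)" "\<lambda>x. snd x - fst x"] by blast
    obtain a b where ab: "a \<in> UI" "b \<in> UO" "a < b" "ij = (a, b)" using q(1) by (cases ij) auto
    have least: "b - a \<le> j' - i'" if "i' \<in> UI" "j' \<in> UO" "i' < j'" for i' j'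
      using q(2)[of "(i', j')"] that ab by simp
    have mid: "q \<notin> UI" "q \<notin> UO" if "a < q" "q < b" for q
      using least[of q b] least[of a q] that ab by auto
    obtain u v where u: "u \<in> R" "a \<in> inpos u" and v: "v \<in> R" "b \<in> outpos v" using ab by (auto simp: UI_def UO_def)
    have bm: "b \<le> m" using ab sub by auto
    obtain P where P: "dpath E P" "set P \<subseteq> R" "hd P = u" "last P = v"
      using strong_on_path[OF st u(1) v(1)] .
    have Pne: "P \<noteq> []" using P by (auto simp: dpath_def)
    have gP: "a + length P < b" using gap[of a P b] P u v ab by simp
    then have b2: "b \<ge> a + 2" using Pne by (cases P) auto
    show False
    proof (cases "b = a + 2")
      case True
      have "length P = 1" using gP True Pne by (cases P) auto
      then obtain w where "P = [w]" by (metis One_nat_def length_0_conv length_Suc_conv)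
      then have uv: "v = u" using P by simp
      define q where "q = cs ! Suc a"
      define zs where "zs = take (Suc a) cs @ [u] @ drop b cs"
      have am: "Suc a < m" using True bm by simp
      have zs: "dcycle E zs" unfolding zs_def using splice[of a "[u]" b] u v uv ab by simp
      have zV: "set zs \<subseteq> V" using splice_set[of a "[u]" b] u cs_in unfolding zs_def by auto
      have lz: "length zs = m" unfolding zs_def using True bm by simp
      have "take (Suc a) cs @ q # drop b cs = cs" 
        using id_take_nth_drop[OF am, symmetric] True by (simp add: q_def)
      then have Cq: "C = insert q (set (take (Suc a) cs) \<union> set (drop b cs))" 
        by (metis set_append list.simps(15) Un_insert_right)
      have "distinct (take (Suc a) cs @ q # drop b cs)" 
        using dist \<open>take (Suc a) cs @ q # drop b cs = cs\<close> by simp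
      then have sz: "set zs = insert u (C - {q})" using Cq unfolding zs_def by auto
      interpret Z: long_z_cycle E V z zs
      proof
        show "hd zs = z" using hd_cs am unfolding zs_def by (cases cs) auto
        show "length ws \<le> length zs" if "dcycle E ws" "set ws \<subseteq> V" "z \<in> set ws" for ws
          using longest_z[OF that] lz by simp
      qed (use zs zV in auto)
      have qC: "q \<in> C" using am by (simp add: q_def)
      have qz: "q \<noteq> z" using dist am cs0 by (metis Zero_not_Suc nth_eq_iff_index_eq q_def zero_less_Suc less_trans)
      have qR: "q \<in> V - set zs" using sz u qC cs_in by auto
      have "(q, y) \<notin> E \<and> (y, q) \<notin> E" if y: "y \<in> V - set zs" for y
      proof (cases "y = q")
        case True then show ?thesis using irr by (simp add: irrefl_def)
      next
        case False
        then have yR: "y \<in> R" using y sz by auto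
        then have "Suc a \<notin> inpos y" "Suc a \<notin> outpos y" using mid[of "Suc a"] True by (auto simp: UI_def UO_def)
        then show ?thesis using am by (auto simp: inpos_def outpos_def q_def)
      qed
      then have "ins E (V - set zs) q = {}" "outs E (V - set zs) q = {}" by (auto simp: ins_def outs_def)
      then have "deg E (V - set zs) q = 0" by (simp add: deg_def)
      then show False using Z.deg_R_ge[OF qR] Z.r_ge2 by simp
    next
      case False
      then have b3: "b \<ge> a + 3" using b2 by simp
      \<comment> \<open>The positions inside the gap are wasted, so the attachments nearly determine those of each vertex.\<close>
      have "Suc ` UI \<union> UO \<subseteq> {1..m} - {a + 2..<b}"
      proof
        fix q assume q: "q \<in> Suc ` UI \<union> UO"
        then have "q \<in> {1..m}" using sub by fastforce
        moreover have "\<not> (a + 2 \<le> q \<and> q < b)"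
        proof
          assume "a + 2 \<le> q \<and> q < b"
          then have "a < q" "q < b" "a < q - 1" "q - 1 < b" by auto
          then have "q \<notin> UO" "q - 1 \<notin> UI" using mid by blast+
          then show False using q by auto
        qed
        ultimately show "q \<in> {1..m} - {a + 2..<b}" by auto
      qed
      then have "card (Suc ` UI \<union> UO) \<le> card ({1..m} - {a + 2..<b})" by (intro card_mono) auto
      also have "\<dots> = m - (b - (a + 2))" using bm b3 by (subst card_Diff_subset) auto
      finally have 1: "card (Suc ` UI \<union> UO) + (b - (a + 2)) \<le> m" using bm by linarith
      have "Suc ` UI \<inter> UO = {}"
      proof -
        have "Suc i' \<notin> UO" if "i' \<in> UI" for i'
          using least[OF that, of "Suc i'"] b2 by auto
        then show ?thesis by auto
      qed
      then have "card (Suc ` UI \<union> UO) = card UI + card UO"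
        using fU by (subst card_Un_disjoint) (auto simp: card_image)
      then have UIO: "card UI + card UO + (b - (a + 2)) \<le> m" using 1 by simp
      have miss: "card (UI - inpos y) + card (UO - outpos y) \<le> 1 \<and> b \<le> a + r" if y: "y \<in> R" for y
      proof -
        have s: "inpos y \<subseteq> UI" "outpos y \<subseteq> UO" using y by (auto simp: UI_def UO_def)
        have "card (UI - inpos y) = card UI - card (inpos y)" "card (inpos y) \<le> card UI"
          "card (UO - outpos y) = card UO - card (outpos y)" "card (outpos y) \<le> card UO"
          using s fU by (auto intro!: card_Diff_subset card_mono)
        then show ?thesis using UIO low[OF y] r4 b3 by linarith
      qed
      have notI: "a \<notin> inpos (?t y)" if y: "y \<in> R" "b \<in> outpos y" for y
      proof
        assume a: "a \<in> inpos (?t y)"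
        obtain P' where P': "dpath E P'" "set P' = R" "length P' = r" "hd P' = ?t y" "last P' = y"
          using path_R[OF y(1)] by auto
        then have "a + r < b" using gap[of a P' b] a y ab by simp
        then show False using miss[OF y(1)] by simp
      qed
      have "b \<in> outpos y" if "y \<in> R" for y
      proof (rule nxt_invariant[where Q = "\<lambda>y. b \<in> outpos y", OF yd, of v])
        show "v \<in> set ys" "b \<in> outpos v" "y \<in> set ys" using v that ys by auto
        fix x assume x: "x \<in> set ys" "b \<in> outpos x"
        then have xR: "x \<in> R" using ys by simp
        have "a \<in> UI - inpos (?t x)" using notI[OF xR x(2)] ab by simp
        then have "card (UI - inpos (?t x)) \<ge> 1" using fU by (metis Suc_le_eq One_nat_def card_gt_0_iff empty_iff finite_Diff)
        then have "card (UO - outpos (?t x)) = 0" using miss[OF tR[OF xR]] by simp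
        then have "UO - outpos (?t x) = {}" using fU by simp
        then show "b \<in> outpos (?t x)" using ab by auto
      qed
      moreover obtain x where "x \<in> set ys" "?t x = u" using nxt_onto[OF yd] u ys by metis
      ultimately show False using notI[of x] u ys by auto
    qed
  qed
  have "\<exists>x\<in>R. \<exists>y\<in>V - R. (x, y) \<in> E"
    using strong_on_leaves[OF strongV, of R] R_nonempty zC zV by blast
  then obtain x y where xy: "x \<in> R" "y \<in> C" "(x, y) \<in> E" by auto
  then have "outs E C x \<noteq> {}" by (auto simp: outs_def)
  then have "card (outpos x) \<noteq> 0" by (simp add: card_O)
  then have "outpos x \<noteq> {}" by auto
  then have ne: "UO \<noteq> {}" using xy by (auto simp: UO_def)
  \<comment> \<open>The position \<open>k\<close> separates the two kinds of attachments.\<close>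
  define k where "k = Max UO"
  have k: "k \<in> UO" "\<And>j. j \<in> UO \<Longrightarrow> j \<le> k" using ne fU by (auto simp: k_def)
  have kI: "k \<le> i" if "i \<in> UI" for i using not_forward[OF that k(1)] by simp
  have km: "k \<le> m" using k(1) sub by auto
  have xt: "?t x \<in> R" using tR xy by blast
  obtain P where P: "dpath E P" "set P = R" "hd P = ?t x" "last P = x" using path_R[OF xy(1)] by auto
  have IU: "inpos v \<subseteq> {k..<m}" "outpos v \<subseteq> {1..k}" if v: "v \<in> R" for v
  proof -
    have "inpos v \<subseteq> UI" "outpos v \<subseteq> UO" using v by (auto simp: UI_def UO_def)
    moreover have "UI \<subseteq> {k..<m}" "UO \<subseteq> {1..k}" using kI k(2) sub by fastforce+
    ultimately show "inpos v \<subseteq> {k..<m}" "outpos v \<subseteq> {1..k}" by blast+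
  qed
  have "Suc ` inpos (?t x) \<inter> inpos x = {}" using bypass_ins[OF P(1,2)] P(3,4) by auto
  then have "card (inpos (?t x)) + card (inpos x) = card (Suc ` inpos (?t x) \<union> inpos x)"
    by (subst card_Un_disjoint) (auto simp: card_image)
  also have "\<dots> \<le> card {k..m}" using IU[OF xt] IU[OF xy(1)] by (intro card_mono) force+
  finally have 1: "card (inpos (?t x)) + card (inpos x) \<le> Suc m - k" by simp
  have "Suc ` outpos (?t x) \<inter> outpos x = {}" using bypass_outs[OF P(1,2)] P(3,4) by auto
  then have "card (outpos (?t x)) + card (outpos x) = card (Suc ` outpos (?t x) \<union> outpos x)"
    by (subst card_Un_disjoint) (auto simp: card_image)
  also have "\<dots> \<le> card {1..Suc k}" using IU[OF xt] IU[OF xy(1)] by (intro card_mono) force+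
  finally have 2: "card (outpos (?t x)) + card (outpos x) \<le> Suc k" by simp
  show False using 1 2 low[OF xt] low[OF xy(1)] km m_large by linarith
qed

end

text \<open>
  Let \<open>n = p - 1\<close> be the length of a cycle through all vertices but \<open>z\<close>. If no out-neighbour of \<open>z\<close> followed
  an in-neighbour within five steps, three shifts of each of the two sets would be disjoint, and the
  degree of \<open>z\<close> would be at most \<open>n / 3\<close>. So some cycle through \<open>z\<close> misses at most four vertices. If
  a longest such cycle misses \<open>r\<close> vertices, the same count with \<open>K = max 2 r\<close> shows that it is long
  compared with \<open>r\<close>.
\<close>

theorem (in no_ham_no_bypass) deg_exception_small: "3 * deg E V z < card V"
proof (rule ccontr)
  assume "\<not> ?thesis"
  then have big: "3 * deg E V z \<ge> card V" by simp
  let ?I = "ins E V z" and ?O = "outs E V z"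
  obtain xs where xs: "dcycle E xs" "set xs = V - {z}" using cycle_avoiding_z .
  have d: "distinct xs" using xs dcycle_distinct by blast
  have n: "length xs + 1 = card V" using dcycle_card[OF xs(1)] xs(2) zV finV
    by (metis Suc_eq_plus1 card_Suc_Diff1)
  have I2: "card ?I \<ge> 2" using two_ins[OF zV] .
  have O2: "card ?O \<ge> 2"
  proof -
    interpret D: no_ham_no_bypass "E\<inverse>" V z by (rule dual_nonham)
    show ?thesis using D.two_ins[OF zV] by simp
  qed
  have IO: "?I \<subseteq> set xs" "?O \<subseteq> set xs" using xs(2) irr by (auto simp: ins_def outs_def irrefl_def)
  have zn: "z \<notin> set xs" "insert z (set xs) = V" using xs(2) zV by auto
  have "2 * card ?I \<le> length xs"
    using bypass_consecutive_ins[OF xs(1) zn(1)] no_bypass zn(2) IO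
    by (intro double_card_le[OF d]) (auto simp: ins_def)
  then have n3: "length xs \<ge> 3" using I2 by simp
  have n6: "length xs \<ge> 6" using shifted_neighbours_bound[OF xs n3, of 2] O2 by simp
  let ?Q = "\<lambda>zs. dcycle E zs \<and> set zs \<subseteq> V \<and> z \<in> set zs"
  obtain zs0 where "?Q zs0" using z_on_cycle by blast
  moreover have "length zs < Suc (card V)" if "?Q zs" for zs
    using that dcycle_card[of E zs] card_mono[OF finV, of "set zs"] by auto
  ultimately obtain zs where zs: "?Q zs" "\<And>ws. ?Q ws \<Longrightarrow> length ws \<le> length zs"
    using ex_has_greatest_nat[of ?Q zs0 length] by blast
  obtain a where a: "a \<in> set zs" "nxt zs a = z"
    using nxt_onto[of zs z] zs(1) dcycle_distinct by blast
  obtain cs where cs: "dcycle E cs" "set cs = set zs" "length cs = length zs" "hd cs = z"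
    using dcycle_rotate[of E zs a] zs(1) a by metis
  interpret L: long_z_cycle E V z cs
    using cs zs by unfold_locales auto
  have far: "(nxt xs ^^ l) a \<notin> ?O" if "a \<in> ?I" "1 \<le> l" "l \<le> L.r" "l \<le> length xs" for a l
  proof
    assume o: "(nxt xs ^^ l) a \<in> ?O"
    have "\<exists>ws. dcycle E ws \<and> length ws + l = length xs + length [z] + 1 \<and> set [z] \<subseteq> set ws \<and> set ws \<subseteq> set xs \<union> set [z]"
      using that o zn IO by (intro dcycle_detour[OF xs(1), of a l]) (auto simp: ins_def outs_def)
    then obtain ws where ws: "dcycle E ws" "length ws + l = length xs + 2" "z \<in> set ws" "set ws \<subseteq> V"
      using zn by auto
    then have "length ws \<le> L.m" using zs(2)[of ws] cs(3) by simp
    then show False using ws(2) n L.card_V that by linarith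
  qed
  have r4: "L.r \<le> 4"
  proof (rule ccontr)
    assume "\<not> L.r \<le> 4"
    then have "3 * card ?O + (5 - 2) * card ?I \<le> length xs"
      using far n6 by (intro shifted_neighbours_bound[OF xs n3]) auto
    then show False using big n by (simp add: deg_def)
  qed
  have "3 * card ?O + (max 2 L.r - 2) * card ?I \<le> length xs"
    using far n6 r4 by (intro shifted_neighbours_bound[OF xs n3]) auto
  moreover have "(max 2 L.r - 2) * 2 \<le> (max 2 L.r - 2) * card ?I" using I2 by (intro mult_le_mono2)
  ultimately have "6 + (max 2 L.r - 2) * 2 \<le> length xs" using O2 by linarith
  then have "L.m + 1 \<ge> 2 * L.r" using n L.card_V r4 by linarith
  then show False using L.impossible[OF r4] by simp
qed

section \<open>Digraphs as relations\<close>

lemma (in digraph) irrefl_arcs_ends: "irrefl (arcs_ends G)"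
  using no_loops by (auto simp: irrefl_def arcs_ends_def arc_to_ends_def)

lemma (in digraph) out_degree_eq: "out_degree G x = card (outs (arcs_ends G) (verts G) x)"
  unfolding out_degree_def
proof (rule bij_betw_same_card)
  show "bij_betw (head G) (out_arcs G x) (outs (arcs_ends G) (verts G) x)" unfolding bij_betw_def
  proof (intro conjI inj_onI)
    fix e f assume "e \<in> out_arcs G x" "f \<in> out_arcs G x" "head G e = head G f"
    then show "e = f" using no_multi_arcs[of e f] by (simp add: arc_to_ends_def)
  qed (force simp: outs_def arcs_ends_def arc_to_ends_def)
qed

lemma (in digraph) in_degree_eq: "in_degree G x = card (ins (arcs_ends G) (verts G) x)"
  unfolding in_degree_def
proof (rule bij_betw_same_card)
  show "bij_betw (tail G) (in_arcs G x) (ins (arcs_ends G) (verts G) x)" unfolding bij_betw_def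
  proof (intro conjI inj_onI)
    fix e f assume "e \<in> in_arcs G x" "f \<in> in_arcs G x" "tail G e = tail G f"
    then show "e = f" using no_multi_arcs[of e f] by (simp add: arc_to_ends_def)
  qed (force simp: ins_def arcs_ends_def arc_to_ends_def)
qed

lemma (in digraph) total_degree_eq: "total_degree G x = deg (arcs_ends G) (verts G) x"
  by (simp add: total_degree_def deg_def out_degree_eq in_degree_eq)

lemma strong_on_induced:
  assumes "strongly_connected (D \<restriction> S)"
  shows "strong_on (arcs_ends D) S"
  unfolding strong_on_def
proof (intro ballI)
  fix x y assume "x \<in> S" "y \<in> S"
  then have "x \<rightarrow>\<^sup>*\<^bsub>D \<restriction> S\<^esub> y" using assms by auto
  then have "(x, y) \<in> rtrancl_on S (arcs_ends (D \<restriction> S))" by (simp add: reachable_def)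
  then show "(x, y) \<in> (arcs_ends D \<inter> S \<times> S)\<^sup>*"
  proof (induction rule: rtrancl_on_induct)
    case (step y z)
    have "arcs_ends (D \<restriction> S) \<subseteq> arcs_ends D \<inter> S \<times> S"
      by (auto simp: arcs_ends_def arc_to_ends_def)
    then show ?case using step by (auto intro: rtrancl_into_rtrancl)
  qed simp
qed

lemma (in wf_digraph) awalk_verts_successively:
  "awalk u c v \<Longrightarrow> successively (\<lambda>x y. (x, y) \<in> arcs_ends G) (awalk_verts u c)"
proof (induction c arbitrary: u)
  case (Cons e c)
  then have w: "e \<in> arcs G" "awalk (head G e) c v" by (auto simp: awalk_Cons_iff)
  have "hd (awalk_verts (head G e) c) = head G e" using w by (cases c) (auto simp: awalk_Cons_iff)
  moreover have "(tail G e, head G e) \<in> arcs_ends G" using w by (auto simp: arcs_ends_def arc_to_ends_def)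
  ultimately show ?case using Cons.IH[OF w(2)] by (simp add: successively_Cons)
qed simp

lemma (in wf_digraph) dcycle_if_hamiltonian:
  assumes "hamiltonian G"
  obtains xs where "dcycle (arcs_ends G) xs" "set xs = verts G"
proof -
  obtain u c where uc: "cycle c" "awalk u c u" "set (awalk_verts u c) = verts G"
    using assms by (auto simp: hamiltonian_def)
  then have c: "c \<noteq> []" by (auto simp: cycle_def)
  then obtain e es where ce: "c = e # es" by (cases c) auto
  define xs where "xs = awalk_verts (head G e) es"
  have aw: "awalk (head G e) es u" "e \<in> arcs G" "tail G e = u" using uc(2) ce by (auto simp: awalk_Cons_iff)
  have "distinct xs" using uc(1) ce by (auto simp: cycle_def xs_def)
  moreover have "hd xs = head G e" "last xs = u" "xs \<noteq> []"
    using aw(1) by (auto simp: xs_def awalk_def)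
  moreover have "(u, head G e) \<in> arcs_ends G" using aw by (auto simp: arcs_ends_def arc_to_ends_def)
  ultimately have "dcycle (arcs_ends G) xs"
    using awalk_verts_successively[OF aw(1)] by (auto simp: dcycle_def dpath_def xs_def)
  moreover have "set xs = verts G"
  proof -
    have "u \<in> set xs" using \<open>last xs = u\<close> \<open>xs \<noteq> []\<close> last_in_set[of xs] by simp
    moreover have "insert u (set xs) = verts G" using uc(3) ce aw(3) by (simp add: xs_def)
    ultimately show ?thesis by (simp add: insert_absorb)
  qed
  ultimately show ?thesis using that by blast
qed

lemma (in wf_digraph) dpath_apath:
  assumes "dpath (arcs_ends G) xs" "set xs \<subseteq> verts G"
  shows "\<exists>P. apath (hd xs) P (last xs) \<and> awalk_verts (hd xs) P = xs"
proof -
  have "xs \<noteq> [] \<Longrightarrow> successively (\<lambda>x y. (x, y) \<in> arcs_ends G) xs \<Longrightarrow> set xs \<subseteq> verts G \<Longrightarrow>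
     \<exists>P. awalk (hd xs) P (last xs) \<and> awalk_verts (hd xs) P = xs"
  proof (induction xs)
    case (Cons x xs)
    show ?case
    proof (cases "xs = []")
      case True
      then show ?thesis using Cons.prems by (intro exI[of _ "[]"]) (auto simp: awalk_Nil_iff)
    next
      case False
      then have a: "(x, hd xs) \<in> arcs_ends G" using Cons.prems by (simp add: successively_Cons)
      obtain P where P: "awalk (hd xs) P (last xs)" "awalk_verts (hd xs) P = xs"
        using Cons False by (auto simp: successively_Cons)
      obtain e where "e \<in> arcs G" "tail G e = x" "head G e = hd xs"
        using a by (auto simp: arcs_ends_def arc_to_ends_def)
      then show ?thesis using P False by (intro exI[of _ "e # P"]) (auto simp: awalk_Cons_iff)
    qed
  qed simp
  then show ?thesis using assms by (auto simp: dpath_def apath_def)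
qed

lemma (in wf_digraph) has_hamiltonian_bypass_if_bypass:
  assumes "bypass (arcs_ends G) (verts G)"
  shows "has_hamiltonian_bypass G"
proof -
  obtain xs where xs: "dpath (arcs_ends G) xs" "set xs = verts G" "(hd xs, last xs) \<in> arcs_ends G"
    using assms by (auto simp: bypass_def)
  obtain P where P: "apath (hd xs) P (last xs)" "awalk_verts (hd xs) P = xs"
    using dpath_apath[OF xs(1)] xs(2) by auto
  then have "hamiltonian_path G (hd xs) P (last xs)" using xs(2) by (simp add: hamiltonian_path_def)
  then show ?thesis using xs(3) unfolding has_hamiltonian_bypass_def by blast
qed

theorem theorem1p5:
  fixes D :: "('a, 'b) pre_digraph" and p :: nat and z :: 'a
  assumes "digraph D"
    and "card (verts D) = p" and "p \<ge> 3"
    and "k_strong 2 D"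
    and "z \<in> verts D"
    and "\<And>x. x \<in> verts D - {z} \<Longrightarrow> total_degree D x \<ge> p"
    and "hamiltonian D \<or> real (total_degree D z) > (real p - 1) / 3"
  shows "has_hamiltonian_bypass D"
proof -
  interpret digraph D by (rule assms(1))
  let ?E = "arcs_ends D" and ?V = "verts D"
  have degs: "deg ?E ?V x \<ge> card ?V" if "x \<in> ?V - {z}" for x
    using assms(2) assms(6)[OF that] by (simp add: total_degree_eq)
  have strong: "strong_on ?E (?V - X)" if "X \<subseteq> ?V" "card X < 2" for X
    using assms(4) that by (auto simp: k_strong_def intro: strong_on_induced)
  have "bypass ?E ?V"
  proof (cases "\<exists>xs. dcycle ?E xs \<and> set xs = ?V")
    case True
    then show ?thesis using bypass_if_hamiltonian[OF irrefl_arcs_ends _ _ _ assms(5) degs] assms(2,3) by blast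
  next
    case False
    then have "\<not> hamiltonian D" using dcycle_if_hamiltonian by blast
    then have "card ?V \<le> 3 * deg ?E ?V z"
      using assms(2,3,7) by (simp add: total_degree_eq field_simps)
    then have "\<not> no_ham_no_bypass ?E ?V z" using no_ham_no_bypass.deg_exception_small by fastforce
    moreover have "strong_on ?E ?V" using strong[of "{}"] by simp
    ultimately show ?thesis
      using False strong irrefl_arcs_ends finite_verts assms(2,3,5) degs
      unfolding no_ham_no_bypass_def by auto
  qed
  then show ?thesis by (rule has_hamiltonian_bypass_if_bypass)
qed

end
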